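(* Let $(W,S)$ be an irreducible Coxeter group of finite rank with $m_{st}<\infty$ for all $s,t\in S$, whose Coxeter graph $G=(S,E)$ is not a tree (i.e. contains a circuit), and let $s_1,s_2\in S$ satisfy $m_{s_1s_2}\ge 4$. Let $V$ be the representation of $W$, and $V_0, V_1\subseteq V$ the subspaces, defined in the context, where $s_1,s_2$ are labelled so that $S_1'$ is infinite. Put $\overline{V}:=V/V_0$ and $\overline{V_1}:=V_1/(V_1\cap V_0)$. If $m_{s_1s_2}>4$, then $\overline{V}$ is an irreducible representation of $W$. If $m_{s_1s_2}=4$, then $\overline{V_1}$ is an irreducible representation of $W$. Moreover, $\overline{V}$ and $\overline{V_1}$ are both infinite dimensional.
   Context: For $s,t\in S$, $m_{st}$ is the order of $st$ in $W$. The Coxeter graph $G=(S,E)$ is the simple undirected graph with vertex set $S$ and an edge $\{s,t\}\in E$ whenever $m_{st}\ge3$ (labels ignored). Irreducible of finite rank means $G$ is connected and $|S|<\infty$. A tree is a connected graph without circuits. A covering of graphs $p:G'=(S',E')\to G=(S,E)$ is a surjective map $p:S'\to S$ sending edges to edges and such that, for every $a\in S'$, $p$ restricts to a bijection from the set of neighbours of $a$ in $G'$ to the set of neighbours of $p(a)$ in $G$. The universal covering of $G$ is the covering $p:G'\to G$ with $G'$ a tree. Construction of $V$. Let $p:G'=(S',E')\to G$ be the universal covering and fix an edge $\{s_1',s_2'\}\in E'$ with $p(s_1')=s_1$, $p(s_2')=s_2$. Let $V$ be the complex vector space with basis $\{\alpha_a\mid a\in S'\}$. For $s\in S$ and $a\in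 S'$ define $s\cdot\alpha_a$ by: (1) if $s=p(a)$, then $s\cdot\alpha_a:=-\alpha_a$; (2) if $s=s_1$, $a=s_2'$, then $s_1\cdot\alpha_{s_2'}:=\alpha_{s_2'}+2\cos\frac{2\pi}{m_{s_1s_2}}\,\alpha_{s_1'}$; (3) if $s=s_2$, $a=s_1'$, then $s_2\cdot\alpha_{s_1'}:=\alpha_{s_1'}+2\cos\frac{2\pi}{m_{s_1s_2}}\,\alpha_{s_2'}$; (4) if $s\ne p(a)$, $(s,a)\ne(s_1,s_2')$, $(s,a)\ne(s_2,s_1')$, and $s$ is not adjacent to $p(a)$ in $G$, then $s\cdot\alpha_a:=\alpha_a$; (5) if $s\ne p(a)$, $(s,a)\ne(s_1,s_2')$, $(s,a)\ne(s_2,s_1')$, and $s$ is adjacent to $p(a)$ in $G$, then $s\cdot\alpha_a:=\alpha_a+2\cos\frac{\pi}{m_{s,p(a)}}\,\alpha_b$, where $b$ is the unique vertex in $p^{-1}(s)$ adjacent to $a$ in $G'$. These formulas define a representation of $W$ on $V$. For $a,b\in S'$ let $\operatorname{d}(a,b)$ be the distance in the tree $G'$. Let $S_1':=\{a\in S'\mid \operatorname{d}(a,s_1')<\operatorname{d}(a,s_2')\}$ and $S_2':=\{a\in S'\mid \operatorname{d}(a,s_2')<\operatorname{d}(a,s_1')\}$. At least one of $S_1',S_2'$ is infinite, and $s_1,s_2$ are labelled so that $|S_1'|=\infty$. Let $$V_1:=\bigoplus_{a\in S_1'}\mathbb{C}\alpha_a,\qquad V_0:=\{v\in V\mid s\cdot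 v=v\text{ for all }s\in S\}.$$ If $m_{s_1s_2}=4$, then $V_1$ is a subrepresentation of $V$. *)

theory Defs
  imports Complex_Main "HOL-Algebra.Algebra" "HOL-Algebra.Algebraic_Closure_Type"
begin

section \<open>Simple undirected graphs, trees and coverings\<close>

record 'a ugraph =
  vertices :: "'a set"
  edges :: "'a set set"

definition simple_graph :: "'a ugraph \<Rightarrow> bool" where
  "simple_graph G \<longleftrightarrow>
     (\<forall>e\<in>edges G. \<exists>u\<in>vertices G. \<exists>v\<in>vertices G. u \<noteq> v \<and> e = {u, v})"

definition neighbours :: "'a ugraph \<Rightarrow> 'a \<Rightarrow> 'a set" where
  "neighbours G a = {b \<in> vertices G. {a, b} \<in> edges G}"

definition walk :: "'a ugraph \<Rightarrow> 'a list \<Rightarrow> bool" where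
  "walk G xs \<longleftrightarrow> xs \<noteq> [] \<and> set xs \<subseteq> vertices G \<and> successively (\<lambda>u v. {u, v} \<in> edges G) xs"

definition connected_graph :: "'a ugraph \<Rightarrow> bool" where
  "connected_graph G \<longleftrightarrow>
     (\<forall>u\<in>vertices G. \<forall>v\<in>vertices G. \<exists>xs. walk G xs \<and> hd xs = u \<and> last xs = v)"

definition circuit :: "'a ugraph \<Rightarrow> 'a list \<Rightarrow> bool" where
  "circuit G xs \<longleftrightarrow>
     walk G xs \<and> 3 \<le> length xs \<and> distinct xs \<and> {last xs, hd xs} \<in> edges G"

definition tree_graph :: "'a ugraph \<Rightarrow> bool" where
  "tree_graph G \<longleftrightarrow> simple_graph G \<and> connected_graph G \<and> (\<nexists>xs. circuit G xs)"

text \<open>Number of edges of a shortest walk; only meaningful in a connected graph.\<close>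

definition graph_dist :: "'a ugraph \<Rightarrow> 'a \<Rightarrow> 'a \<Rightarrow> nat" where
  "graph_dist G u v =
     (LEAST n. \<exists>xs. walk G xs \<and> hd xs = u \<and> last xs = v \<and> length xs = Suc n)"

definition graph_covering :: "('b \<Rightarrow> 'a) \<Rightarrow> 'b ugraph \<Rightarrow> 'a ugraph \<Rightarrow> bool" where
  "graph_covering p G' G \<longleftrightarrow>
     simple_graph G' \<and> simple_graph G \<and>
     p ` vertices G' = vertices G \<and>
     (\<forall>e\<in>edges G'. p ` e \<in> edges G) \<and>
     (\<forall>a\<in>vertices G'. bij_betw p (neighbours G' a) (neighbours G (p a)))"

definition universal_covering :: "('b \<Rightarrow> 'a) \<Rightarrow> 'b ugraph \<Rightarrow> 'a ugraph \<Rightarrow> bool" where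
  "universal_covering p G' G \<longleftrightarrow> graph_covering p G' G \<and> tree_graph G'"


section \<open>Coxeter groups\<close>

text \<open>The order of \<open>s t\<close> in \<open>W\<close>; the value 0 stands for infinite order.\<close>

definition cox_m :: "('w, 'k) monoid_scheme \<Rightarrow> 'w \<Rightarrow> 'w \<Rightarrow> nat" where
  "cox_m W s t = group.ord W (s \<otimes>\<^bsub>W\<^esub> t)"

text \<open>
  One insertion of a relator \<open>(s t)\<^bsup>m\<^esup>\<close>, where \<open>m\<close> is the order of \<open>s t\<close>, in a word over \<open>S\<close>.
  The case \<open>s = t\<close> has \<open>m = 1\<close> and inserts \<open>s s\<close>, so formal inverses of the letters are not
  needed; for \<open>m = 0\<close> (infinite order) nothing is inserted.
\<close>

definition cox_step :: "('w, 'k) monoid_scheme \<Rightarrow> 'w set \<Rightarrow> 'w list \<Rightarrow> 'w list \<Rightarrow> bool" where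
  "cox_step W S us vs \<longleftrightarrow>
     (\<exists>xs ys s t. s \<in> S \<and> t \<in> S \<and> us = xs @ ys \<and>
        vs = xs @ concat (replicate (cox_m W s t) [s, t]) @ ys)"

text \<open>
  \<open>W\<close> has the presentation \<open>\<langle>S | (s t)\<^bsup>m s t\<^esup> = 1\<rangle>\<close>: \<open>S\<close> is a generating set of involutions, and two
  words over \<open>S\<close> have the same value in \<open>W\<close> iff they are equal modulo the relations.
\<close>

definition coxeter_group :: "('w, 'k) monoid_scheme \<Rightarrow> 'w set \<Rightarrow> bool" where
  "coxeter_group W S \<longleftrightarrow>
     group W \<and> S \<subseteq> carrier W \<and> generate W S = carrier W \<and>
     (\<forall>s\<in>S. group.ord W s = 2) \<and>
     (\<forall>us\<in>lists S. \<forall>vs\<in>lists S.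
        foldr (monoid.mult W) us \<one>\<^bsub>W\<^esub> = foldr (monoid.mult W) vs \<one>\<^bsub>W\<^esub>
          \<longleftrightarrow> equivclp (cox_step W S) us vs)"

definition coxeter_graph :: "('w, 'k) monoid_scheme \<Rightarrow> 'w set \<Rightarrow> 'w ugraph" where
  "coxeter_graph W S =
     \<lparr>vertices = S,
      edges = {{s, t} | s t. s \<in> S \<and> t \<in> S \<and> (cox_m W s t \<ge> 3 \<or> cox_m W s t = 0)}\<rparr>"

definition irreducible_coxeter :: "('w, 'k) monoid_scheme \<Rightarrow> 'w set \<Rightarrow> bool" where
  "irreducible_coxeter W S \<longleftrightarrow> coxeter_group W S \<and> connected_graph (coxeter_graph W S)"


section \<open>Complex vector spaces and representations\<close>

text \<open>
  Complex vector spaces are HOL-Algebra modules over the field of complex numbers.  Their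
  record fields \<open>mult\<close> and \<open>one\<close> play no role.
\<close>

abbreviation CC :: "complex ring" where
  "CC \<equiv> ring_of_type_algebra"

text \<open>The vector space of finitely supported functions on \<open>A\<close>, with basis \<open>basis_vec a\<close>, \<open>a \<in> A\<close>.\<close>

definition free_space :: "'b set \<Rightarrow> (complex, 'b \<Rightarrow> complex) module" where
  "free_space A =
     \<lparr>carrier = {v. finite {a. v a \<noteq> 0} \<and> {a. v a \<noteq> 0} \<subseteq> A},
      monoid.mult = undefined, one = undefined,
      ring.zero = (\<lambda>_. 0), add = (\<lambda>u v a. u a + v a), module.smult = (\<lambda>c v a. c * v a)\<rparr>"

definition basis_vec :: "'b \<Rightarrow> 'b \<Rightarrow> complex" where
  "basis_vec a = (\<lambda>b. if b = a then 1 else 0)"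

definition lin_span :: "(complex, 'v) module \<Rightarrow> 'v set \<Rightarrow> 'v set" where
  "lin_span M B = (\<lambda>U. submodule U CC M) hull B"

definition infinite_dim :: "(complex, 'v) module \<Rightarrow> bool" where
  "infinite_dim M \<longleftrightarrow> (\<nexists>B. finite B \<and> B \<subseteq> carrier M \<and> lin_span M B = carrier M)"

definition quot_space :: "(complex, 'v) module \<Rightarrow> 'v set \<Rightarrow> (complex, 'v set) module" where
  "quot_space M N =
     \<lparr>carrier = a_rcosets\<^bsub>M\<^esub> N,
      monoid.mult = undefined, one = undefined,
      ring.zero = N,
      add = set_add M,
      module.smult = (\<lambda>c K. \<Union>x\<in>K. N +>\<^bsub>M\<^esub> (c \<odot>\<^bsub>M\<^esub> x))\<rparr>"

text \<open>\<open>group_action\<close> says that \<open>\<rho>\<close> is a homomorphism from \<open>G\<close> to the bijections of \<open>carrier M\<close>.\<close>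

definition representation ::
    "('w, 'k) monoid_scheme \<Rightarrow> (complex, 'v) module \<Rightarrow> ('w \<Rightarrow> 'v \<Rightarrow> 'v) \<Rightarrow> bool" where
  "representation G M \<rho> \<longleftrightarrow>
     Module.module CC M \<and> group_action G (carrier M) \<rho> \<and>
     (\<forall>g\<in>carrier G. \<forall>x\<in>carrier M. \<forall>y\<in>carrier M. \<rho> g (x \<oplus>\<^bsub>M\<^esub> y) = \<rho> g x \<oplus>\<^bsub>M\<^esub> \<rho> g y) \<and>
     (\<forall>g\<in>carrier G. \<forall>c. \<forall>x\<in>carrier M. \<rho> g (c \<odot>\<^bsub>M\<^esub> x) = c \<odot>\<^bsub>M\<^esub> \<rho> g x)"

definition irreducible_representation ::
    "('w, 'k) monoid_scheme \<Rightarrow> (complex, 'v) module \<Rightarrow> ('w \<Rightarrow> 'v \<Rightarrow> 'v) \<Rightarrow> bool" where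
  "irreducible_representation G M \<rho> \<longleftrightarrow>
     representation G M \<rho> \<and> carrier M \<noteq> {\<zero>\<^bsub>M\<^esub>} \<and>
     (\<forall>U. submodule U CC M \<and> (\<forall>g\<in>carrier G. \<rho> g ` U \<subseteq> U) \<longrightarrow> U = {\<zero>\<^bsub>M\<^esub>} \<or> U = carrier M)"

text \<open>
  The action induced on the quotient by \<open>N\<close>: if \<open>\<rho> g\<close> is linear and maps \<open>N\<close> onto \<open>N\<close>, then
  the image of the set \<open>N + x\<close> is the coset \<open>N + \<rho> g x\<close>.
\<close>

definition quot_action ::
    "(complex, 'v) module \<Rightarrow> 'v set \<Rightarrow> ('w \<Rightarrow> 'v \<Rightarrow> 'v) \<Rightarrow> 'w \<Rightarrow> 'v set \<Rightarrow> 'v set" where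
  "quot_action M N \<rho> = (\<lambda>g. \<lambda>K\<in>carrier (quot_space M N). \<rho> g ` K)"


section \<open>The representation on the free space over the universal covering\<close>

text \<open>
  The vector \<open>s \<cdot> \<alpha>\<^sub>a\<close>.  Here \<open>p\<close> is the covering map from \<open>G'\<close> to the Coxeter graph of
  \<open>(W, S)\<close>, and \<open>a1\<close>, \<open>a2\<close> are the ends of the distinguished edge of \<open>G'\<close> over \<open>s1\<close>, \<open>s2\<close>.
\<close>

definition gen_on_basis ::
    "('w, 'k) monoid_scheme \<Rightarrow> 'w set \<Rightarrow> 'b ugraph \<Rightarrow> ('b \<Rightarrow> 'w) \<Rightarrow> 'b \<Rightarrow> 'b \<Rightarrow>
       'w \<Rightarrow> 'b \<Rightarrow> 'b \<Rightarrow> complex" where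
  "gen_on_basis W S G' p a1 a2 s a =
    (let V = free_space (vertices G'); s1 = p a1; s2 = p a2 in
     if s = p a then \<ominus>\<^bsub>V\<^esub> basis_vec a
     else if s = s1 \<and> a = a2 then
       basis_vec a2 \<oplus>\<^bsub>V\<^esub> complex_of_real (2 * cos (2 * pi / cox_m W s1 s2)) \<odot>\<^bsub>V\<^esub> basis_vec a1
     else if s = s2 \<and> a = a1 then
       basis_vec a1 \<oplus>\<^bsub>V\<^esub> complex_of_real (2 * cos (2 * pi / cox_m W s1 s2)) \<odot>\<^bsub>V\<^esub> basis_vec a2
     else if {s, p a} \<notin> edges (coxeter_graph W S) then basis_vec a
     else basis_vec a \<oplus>\<^bsub>V\<^esub> complex_of_real (2 * cos (pi / cox_m W s (p a))) \<odot>\<^bsub>V\<^esub>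
            basis_vec (THE b. b \<in> vertices G' \<and> p b = s \<and> {a, b} \<in> edges G'))"

definition fixed_space ::
    "'w set \<Rightarrow> (complex, 'v) module \<Rightarrow> ('w \<Rightarrow> 'v \<Rightarrow> 'v) \<Rightarrow> 'v set" where
  "fixed_space S M \<rho> = {v \<in> carrier M. \<forall>s\<in>S. \<rho> s v = v}"

definition half_tree :: "'b ugraph \<Rightarrow> 'b \<Rightarrow> 'b \<Rightarrow> 'b set" where
  "half_tree G' a1 a2 = {a \<in> vertices G'. graph_dist G' a a1 < graph_dist G' a a2}"

end

theory Submission
  imports Defs
begin

text \<open>
  Write \<open>\<alpha>\<^sub>a\<close> for \<open>basis_vec a\<close>.  If \<open>v\<close> is not fixed by \<open>s \<in> S\<close>, then \<open>s v - v\<close> is a nonzero vector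
  supported on the fibre over \<open>s\<close>.  For \<open>t\<close> adjacent to \<open>s\<close>, the operator \<open>t - 1\<close> moves a vector
  supported on the fibre over \<open>s\<close> along the edges of the covering graph to the fibre over \<open>t\<close>,
  so an invariant subspace that is not contained in \<open>V\<^sub>0\<close> contains a vector supported on the fibre over
  \<open>s\<^sub>1\<close> with nonzero coefficient at \<open>s\<^sub>1'\<close>.  Going from there to the fibre over \<open>s\<^sub>2\<close> and back multiplies
  \<open>\<alpha>\<^sub>a\<close> by \<open>4 cos\<^sup>2 (\<pi>/m)\<close>, except at \<open>a = s\<^sub>1'\<close>, where the factor is \<open>4 cos\<^sup>2 (2\<pi>/m)\<close>.  These numbers
  differ for \<open>m \<ge> 4\<close>, so the subspace contains the basis vector at \<open>s\<^sub>1'\<close>, and then all others by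
  connectivity.  For \<open>m = 4\<close> the distinguished edge has coefficient 0 and everything stays in the
  half tree.  The quotients are infinite dimensional because \<open>s - 1\<close> kills \<open>V\<^sub>0\<close>, but is \<open>-2\<close> on the
  infinitely many basis vectors in some fibre.
\<close>

section \<open>Actions on quotients of modules\<close>

lemma CC_simps [simp]:
  "carrier CC = UNIV" "add CC = (+)" "monoid.mult CC = (*)" "\<zero>\<^bsub>CC\<^esub> = 0" "\<one>\<^bsub>CC\<^esub> = 1"
  by (simp_all add: ring_of_type_algebra_def)

lemma CC_cring: "cring CC"
  by (rule cring_from_type_algebra)

lemma CC_minus_one: "\<ominus>\<^bsub>CC\<^esub> 1 = -1"
proof -
  interpret CC: cring CC by (rule CC_cring)
  have "\<ominus>\<^bsub>CC\<^esub> 1 \<oplus>\<^bsub>CC\<^esub> 1 = \<zero>\<^bsub>CC\<^esub>"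
    by (rule CC.l_neg) simp
  then show ?thesis by (simp add: eq_neg_iff_add_eq_0)
qed

lemma module_minus:
  fixes M :: "(complex, 'v) module"
  assumes "Module.module CC M" "x \<in> carrier M"
  shows "(-1) \<odot>\<^bsub>M\<^esub> x = \<ominus>\<^bsub>M\<^esub> x"
proof -
  interpret module CC M by fact
  show ?thesis
    using smult_l_minus[of 1 x] assms by (simp add: CC_minus_one smult_one[simplified])
qed

lemma submodule_CC_I:
  fixes M :: "(complex, 'v) module"
  assumes M: "Module.module CC M" and "H \<subseteq> carrier M" and "\<zero>\<^bsub>M\<^esub> \<in> H"
    and "\<And>x y. x \<in> H \<Longrightarrow> y \<in> H \<Longrightarrow> x \<oplus>\<^bsub>M\<^esub> y \<in> H"
    and smult: "\<And>c x. x \<in> H \<Longrightarrow> c \<odot>\<^bsub>M\<^esub> x \<in> H"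
  shows "submodule H CC M"
proof -
  interpret module CC M by fact
  have "\<ominus>\<^bsub>M\<^esub> x \<in> H" if "x \<in> H" for x
    using smult[OF that, of "-1"] module_minus[OF M, of x] that assms(2) by auto
  then show ?thesis by (intro submoduleI) (use assms in auto)
qed

lemma submodule_zero: "submodule U R M \<Longrightarrow> \<zero>\<^bsub>M\<^esub> \<in> U"
  using subgroup.one_closed[OF submodule.axioms(1)] by fastforce

section \<open>Quotient spaces in coset form\<close>

locale module_quotient = module CC M for M :: "(complex, 'v) module" (structure) +
  fixes N :: "'v set"
  assumes submod: "submodule N CC M"
begin

lemma N_subset: "N \<subseteq> carrier M"
  and N_smult: "x \<in> N \<Longrightarrow> c \<odot>\<^bsub>M\<^esub> x \<in> N"
  using submoduleE[OF submod] by auto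

lemma N_carrier: "x \<in> N \<Longrightarrow> x \<in> carrier M"
  using N_subset by blast

sublocale N: abelian_subgroup N M
proof (rule abelian_subgroupI3)
  show "additive_subgroup N M"
    using submodule.axioms(1)[OF submod] by (simp add: additive_subgroup_def)
qed (rule M.abelian_group_axioms)

abbreviation Q where "Q \<equiv> quot_space M N"
abbreviation coset where "coset x \<equiv> N +>\<^bsub>M\<^esub> x"

lemma carrier_Q: "carrier Q = coset ` carrier M"
  by (auto simp: quot_space_def A_RCOSETS_def')

text \<open>The zero of \<open>Q\<close> is \<open>N\<close> itself; as the coset of zero it fits
  \<open>add_Q\<close> and \<open>smult_Q\<close> like every other element.\<close>

lemma zero_Q: "\<zero>\<^bsub>Q\<^esub> = coset \<zero>\<^bsub>M\<^esub>"
  using N_subset by (simp add: quot_space_def)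

lemma add_Q:
  "x \<in> carrier M \<Longrightarrow> y \<in> carrier M \<Longrightarrow> coset x \<oplus>\<^bsub>Q\<^esub> coset y = coset (x \<oplus>\<^bsub>M\<^esub> y)"
  by (simp add: quot_space_def N.a_rcos_sum)

lemma mem_coset: "y \<in> coset x \<longleftrightarrow> (\<exists>n\<in>N. y = n \<oplus>\<^bsub>M\<^esub> x)"
  by (auto simp: a_r_coset_def')

lemma coset_eq: "x \<in> carrier M \<Longrightarrow> y \<in> coset x \<Longrightarrow> coset y = coset x"
  using M.a_repr_independence[of y N x] N.a_subgroup by simp

lemma coset_absorb: "x \<in> N \<Longrightarrow> coset x = N"
  using M.a_coset_join2[of x N] N.a_subgroup N_subset by auto

lemma coset_self: "x \<in> carrier M \<Longrightarrow> x \<in> coset x"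
  by (rule N.a_rcos_self)

lemma coset_eqD:
  assumes "coset x = coset y" "x \<in> carrier M" "y \<in> carrier M"
  obtains n where "n \<in> N" "x = n \<oplus>\<^bsub>M\<^esub> y"
  using coset_self[OF assms(2)] assms(1) by (auto simp: mem_coset)

text \<open>In \<open>quot_space\<close> a scalar multiple is a union of cosets, one for each
  representative. Since \<open>N\<close> is closed under scalars these cosets all coincide, and the
  union collapses to one of them.\<close>

lemma smult_Q:
  assumes x: "x \<in> carrier M"
  shows "c \<odot>\<^bsub>Q\<^esub> coset x = coset (c \<odot>\<^bsub>M\<^esub> x)"
proof -
  have "coset (c \<odot>\<^bsub>M\<^esub> y) = coset (c \<odot>\<^bsub>M\<^esub> x)" if "y \<in> coset x" for y
  proof -
    from that obtain n where n: "n \<in> N" "y = n \<oplus>\<^bsub>M\<^esub> x" unfolding mem_coset by blast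
    then have "c \<odot>\<^bsub>M\<^esub> y = c \<odot>\<^bsub>M\<^esub> n \<oplus>\<^bsub>M\<^esub> c \<odot>\<^bsub>M\<^esub> x"
      using N_subset x by (simp add: smult_r_distr subsetD)
    then have "c \<odot>\<^bsub>M\<^esub> y \<in> coset (c \<odot>\<^bsub>M\<^esub> x)"
      using N_smult[OF n(1)] unfolding mem_coset by blast
    then show ?thesis using x by (intro coset_eq) simp_all
  qed
  then have "(\<Union>y\<in>coset x. coset (c \<odot>\<^bsub>M\<^esub> y)) = coset (c \<odot>\<^bsub>M\<^esub> x)"
    using coset_self[OF x] by blast
  then show ?thesis by (simp add: quot_space_def)
qed

lemma module_Q: "Module.module CC Q"
proof (rule moduleI)
  show "abelian_group Q"
  proof (rule abelian_groupI)
    fix K assume "K \<in> carrier Q"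
    then obtain x where x: "x \<in> carrier M" "K = coset x" by (auto simp: carrier_Q)
    then show "\<exists>L\<in>carrier Q. L \<oplus>\<^bsub>Q\<^esub> K = \<zero>\<^bsub>Q\<^esub>"
      by (intro bexI[of _ "coset (\<ominus>\<^bsub>M\<^esub> x)"]) (auto simp: add_Q carrier_Q zero_Q M.l_neg)
  \<comment> \<open>With \<open>M.a_coset_add_zero\<close> active, the zero coset would turn back
    into \<open>N\<close>, and \<open>add_Q\<close> would no longer match.\<close>
  qed (auto simp: carrier_Q zero_Q add_Q M.a_ac simp del: M.a_coset_add_zero)
next
  show "cring CC" by (rule CC_cring)
qed (use smult_l_distr smult_r_distr smult_assoc1 smult_one in \<open>auto simp: carrier_Q add_Q smult_Q\<close>)

lemma submodule_preimage:
  assumes U: "submodule U CC Q"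
  shows "submodule {x \<in> carrier M. coset x \<in> U} CC M"
proof (rule submodule_CC_I)
  note U = module.submoduleE[OF module_Q U]
  have "N \<in> U"
    using submodule_zero[OF assms] by (simp add: quot_space_def)
  then show "\<zero>\<^bsub>M\<^esub> \<in> {x \<in> carrier M. coset x \<in> U}" using N_subset by simp
  show "x \<oplus>\<^bsub>M\<^esub> y \<in> {x \<in> carrier M. coset x \<in> U}"
    if "x \<in> {x \<in> carrier M. coset x \<in> U}" "y \<in> {x \<in> carrier M. coset x \<in> U}" for x y
    using that U(5)[of "coset x" "coset y"] by (auto simp: add_Q)
  show "c \<odot>\<^bsub>M\<^esub> x \<in> {x \<in> carrier M. coset x \<in> U}" if "x \<in> {x \<in> carrier M. coset x \<in> U}" for c x
    using that U(4)[of c "coset x"] by (auto simp: smult_Q)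
qed (auto intro: module_axioms)

lemma submodule_image:
  assumes U: "submodule U CC M"
  shows "submodule (coset ` U) CC Q"
proof (rule submodule_CC_I[OF module_Q])
  note U = submoduleE[OF U]
  show "coset ` U \<subseteq> carrier Q" using U(1) by (auto simp: carrier_Q)
  show "\<zero>\<^bsub>Q\<^esub> \<in> coset ` U"
    using submodule_zero[OF assms] unfolding zero_Q by auto
  show "K \<oplus>\<^bsub>Q\<^esub> L \<in> coset ` U" if XY: "K \<in> coset ` U" "L \<in> coset ` U" for K L
  proof -
    from XY obtain x y where "x \<in> U" "y \<in> U" "K = coset x" "L = coset y" by blast
    then have "K \<oplus>\<^bsub>Q\<^esub> L = coset (x \<oplus>\<^bsub>M\<^esub> y)" using U(1) by (auto intro!: add_Q)
    then show ?thesis using U(5) \<open>x \<in> U\<close> \<open>y \<in> U\<close> by auto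
  qed
  show "c \<odot>\<^bsub>Q\<^esub> K \<in> coset ` U" if "K \<in> coset ` U" for c K
  proof -
    from that obtain x where "x \<in> U" "K = coset x" by blast
    then have "c \<odot>\<^bsub>Q\<^esub> K = coset (c \<odot>\<^bsub>M\<^esub> x)" using U(1) by (auto intro!: smult_Q)
    then show ?thesis using U(4)[of c x] \<open>x \<in> U\<close> by auto
  qed
qed

end

section \<open>Linear group actions and the actions they induce on quotients\<close>

lemma group_action_restrictI:
  assumes G: "group G"
    and closed: "\<And>g x. g \<in> carrier G \<Longrightarrow> x \<in> E \<Longrightarrow> \<phi> g x \<in> E"
    and one: "\<And>x. x \<in> E \<Longrightarrow> \<phi> \<one>\<^bsub>G\<^esub> x = x"
    and mult: "\<And>g h x. g \<in> carrier G \<Longrightarrow> h \<in> carrier G \<Longrightarrow> x \<in> E \<Longrightarrow>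
      \<phi> (g \<otimes>\<^bsub>G\<^esub> h) x = \<phi> g (\<phi> h x)"
  shows "group_action G E (\<lambda>g. restrict (\<phi> g) E)"
proof -
  interpret group G by fact
  have "bij_betw (\<phi> g) E E" if g: "g \<in> carrier G" for g
  proof (rule bij_betwI[of _ _ _ "\<phi> (inv\<^bsub>G\<^esub> g)"])
    show "\<phi> (inv\<^bsub>G\<^esub> g) (\<phi> g x) = x" if "x \<in> E" for x
      using mult[of "inv\<^bsub>G\<^esub> g" g x] g that one by simp
    show "\<phi> g (\<phi> (inv\<^bsub>G\<^esub> g) y) = y" if "y \<in> E" for y
      using mult[of g "inv\<^bsub>G\<^esub> g" y] g that one by simp
  qed (use closed g in auto)
  \<comment> \<open>\<open>Bij E\<close> contains only maps that are \<open>undefined\<close>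
    outside \<open>E\<close>, hence the restriction.\<close>
  then have Bij: "restrict (\<phi> g) E \<in> Bij E" if "g \<in> carrier G" for g
    using that by (auto simp: Bij_def cong: bij_betw_cong)
  have "(\<lambda>g. restrict (\<phi> g) E) \<in> hom G (BijGroup E)"
    by (rule homI) (use Bij closed mult in \<open>auto simp: BijGroup_def compose_def fun_eq_iff\<close>)
  then show ?thesis
    by (simp add: group_action_def group_hom_def group_hom_axioms_def group_BijGroup G)
qed

text \<open>The pointwise content of \<open>representation\<close>. It says nothing about values
  outside the carrier, so the same \<open>\<rho>\<close> also acts on every invariant submodule
  without being restricted.\<close>

locale linear_action = module CC M for M :: "(complex, 'v) module" (structure) +
  fixes G :: "('w, 'k) monoid_scheme" and \<rho> :: "'w \<Rightarrow> 'v \<Rightarrow> 'v"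
  assumes group: "group G"
    and act_closed: "g \<in> carrier G \<Longrightarrow> x \<in> carrier M \<Longrightarrow> \<rho> g x \<in> carrier M"
    and act_one: "x \<in> carrier M \<Longrightarrow> \<rho> \<one>\<^bsub>G\<^esub> x = x"
    and act_mult: "g \<in> carrier G \<Longrightarrow> h \<in> carrier G \<Longrightarrow> x \<in> carrier M \<Longrightarrow>
      \<rho> (g \<otimes>\<^bsub>G\<^esub> h) x = \<rho> g (\<rho> h x)"
    and act_add: "g \<in> carrier G \<Longrightarrow> x \<in> carrier M \<Longrightarrow> y \<in> carrier M \<Longrightarrow>
      \<rho> g (x \<oplus>\<^bsub>M\<^esub> y) = \<rho> g x \<oplus>\<^bsub>M\<^esub> \<rho> g y"
    and act_smult: "g \<in> carrier G \<Longrightarrow> x \<in> carrier M \<Longrightarrow> \<rho> g (c \<odot>\<^bsub>M\<^esub> x) = c \<odot>\<^bsub>M\<^esub> \<rho> g x"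

lemma representation_linear_action:
  assumes "representation G M \<rho>"
  shows "linear_action M G \<rho>"
proof -
  interpret M: module CC M using assms by (simp add: representation_def)
  interpret group_action G "carrier M" \<rho> using assms by (simp add: representation_def)
  interpret group_hom G "BijGroup (carrier M)" \<rho> by (rule group_hom)
  show ?thesis
  proof
    show "\<rho> \<one>\<^bsub>G\<^esub> x = x" if "x \<in> carrier M" for x
      using id_eq_one that by (metis restrict_apply')
    show "\<rho> g x \<in> carrier M" if "g \<in> carrier G" "x \<in> carrier M" for g x
      using element_image that by blast
    show "\<rho> (g \<otimes>\<^bsub>G\<^esub> h) x = \<rho> g (\<rho> h x)"
      if "g \<in> carrier G" "h \<in> carrier G" "x \<in> carrier M" for g h x
      by (rule composition_rule[OF that(3,1,2)])
  qed (use assms in \<open>simp_all add: representation_def\<close>)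
qed

lemma linear_action_submodule:
  assumes "linear_action M G \<rho>" and U: "submodule U CC M"
    and inv: "\<And>g x. g \<in> carrier G \<Longrightarrow> x \<in> U \<Longrightarrow> \<rho> g x \<in> U"
  shows "linear_action (M\<lparr>carrier := U\<rparr>) G \<rho>"
proof -
  interpret linear_action M G \<rho> by fact
  interpret U: module CC "M\<lparr>carrier := U\<rparr>"
    by (rule submodule.submodule_is_module[OF U module_axioms])
  have sub: "x \<in> carrier M" if "x \<in> U" for x using submoduleE(1)[OF U] that by blast
  show ?thesis
    by (intro linear_action.intro linear_action_axioms.intro U.module_axioms group)
      (simp_all add: sub inv act_one act_mult act_add act_smult)
qed

locale quotient_action = linear_action M G \<rho> + module_quotient M N
  for M :: "(complex, 'v) module" (structure) and G :: "('w, 'k) monoid_scheme" and \<rho> and N +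
  assumes N_invariant: "g \<in> carrier G \<Longrightarrow> x \<in> N \<Longrightarrow> \<rho> g x \<in> N"
begin

text \<open>Linearity and invariance of \<open>N\<close> give one inclusion. For the other, a vector
  \<open>n\<close> of \<open>N\<close> is the image of \<open>\<rho> (inv g) n\<close>, which lies
  in \<open>N\<close> as well.\<close>

lemma image_coset:
  assumes g: "g \<in> carrier G" and x: "x \<in> carrier M"
  shows "\<rho> g ` coset x = coset (\<rho> g x)"
proof (intro equalityI subsetI)
  fix y assume "y \<in> \<rho> g ` coset x"
  then obtain z where "z \<in> coset x" "y = \<rho> g z" by (rule imageE)
  then obtain n where n: "n \<in> N" "y = \<rho> g (n \<oplus>\<^bsub>M\<^esub> x)" by (auto simp only: mem_coset)
  then have "y = \<rho> g n \<oplus>\<^bsub>M\<^esub> \<rho> g x" using act_add[OF g N_carrier[OF n(1)] x] by simp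
  then show "y \<in> coset (\<rho> g x)"
    using N_invariant[OF g n(1)] by (auto simp only: mem_coset)
next
  interpret G: group G by (rule group)
  have g': "inv\<^bsub>G\<^esub> g \<in> carrier G" using g by (rule G.inv_closed)
  fix y assume "y \<in> coset (\<rho> g x)"
  then obtain n where n: "n \<in> N" "y = n \<oplus>\<^bsub>M\<^esub> \<rho> g x" by (auto simp only: mem_coset)
  have n': "\<rho> (inv\<^bsub>G\<^esub> g) n \<in> N" by (rule N_invariant[OF g' n(1)])
  have "\<rho> g (\<rho> (inv\<^bsub>G\<^esub> g) n) = n"
    unfolding act_mult[OF g g' N_carrier[OF n(1)], symmetric] G.r_inv[OF g]
    by (rule act_one[OF N_carrier[OF n(1)]])
  then have "y = \<rho> g (\<rho> (inv\<^bsub>G\<^esub> g) n \<oplus>\<^bsub>M\<^esub> x)"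
    using n(2) act_add[OF g N_carrier[OF n'] x] by simp
  moreover have "\<rho> (inv\<^bsub>G\<^esub> g) n \<oplus>\<^bsub>M\<^esub> x \<in> coset x"
    using n' by (auto simp only: mem_coset)
  ultimately show "y \<in> \<rho> g ` coset x" by (rule image_eqI)
qed

lemma representation_Q: "representation G Q (quot_action M N \<rho>)"
proof -
  have "group_action G (carrier Q) (quot_action M N \<rho>)"
    unfolding quot_action_def
  proof (rule group_action_restrictI[OF group])
    interpret G: group G by (rule group)
    fix K assume "K \<in> carrier Q"
    then obtain x where x: "x \<in> carrier M" "K = coset x" unfolding carrier_Q by (rule imageE)
    show "\<rho> \<one>\<^bsub>G\<^esub> ` K = K" using x by (simp add: image_coset act_one)
    show "\<rho> g ` K \<in> carrier Q" if "g \<in> carrier G" for g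
      using x that by (simp add: carrier_Q image_coset act_closed)
    show "\<rho> (g \<otimes>\<^bsub>G\<^esub> h) ` K = \<rho> g ` \<rho> h ` K" if "g \<in> carrier G" "h \<in> carrier G" for g h
      \<comment> \<open>The nested images have to stay separate for \<open>image_coset\<close> to
        rewrite them one after the other.\<close>
      using x that by (simp add: image_coset act_closed act_mult del: image_image)
  qed
  moreover have "quot_action M N \<rho> g (coset x) = coset (\<rho> g x)"
    if "g \<in> carrier G" "x \<in> carrier M" for g x
    using that by (simp add: quot_action_def carrier_Q image_coset)
  ultimately show ?thesis
    using module_Q
    by (auto simp: representation_def carrier_Q add_Q smult_Q act_add act_smult act_closed)
qed

text \<open>An invariant subspace of the quotient is the image of its preimage in \<open>M\<close>,
  which is again invariant. A preimage inside \<open>N\<close> gives the zero subspace, and any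
  other is everything by \<open>irr\<close>.\<close>

lemma irreducible_Q:
  assumes nontriv: "N \<noteq> carrier M"
    and irr: "\<And>U. submodule U CC M \<Longrightarrow> \<not> U \<subseteq> N \<Longrightarrow>
      (\<And>g x. g \<in> carrier G \<Longrightarrow> x \<in> U \<Longrightarrow> \<rho> g x \<in> U) \<Longrightarrow> U = carrier M"
  shows "irreducible_representation G Q (quot_action M N \<rho>)"
  unfolding irreducible_representation_def
proof (intro conjI allI impI)
  show "representation G Q (quot_action M N \<rho>)" by (rule representation_Q)
  obtain x where "x \<in> carrier M" "x \<notin> N" using nontriv N_subset by auto
  then have "coset x \<in> carrier Q" "coset x \<noteq> \<zero>\<^bsub>Q\<^esub>"
    using coset_self[of x] by (auto simp: carrier_Q) (simp add: quot_space_def)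
  then show "carrier Q \<noteq> {\<zero>\<^bsub>Q\<^esub>}" by auto
next
  fix U assume U: "submodule U CC Q \<and> (\<forall>g\<in>carrier G. quot_action M N \<rho> g ` U \<subseteq> U)"
  have "U \<subseteq> carrier Q" "U \<noteq> {}" using module.submoduleE[OF module_Q] U by auto
  define U' where "U' = {x \<in> carrier M. coset x \<in> U}"
  have U_eq: "U = coset ` U'" using \<open>U \<subseteq> carrier Q\<close> by (auto simp: U'_def carrier_Q)
  show "U = {\<zero>\<^bsub>Q\<^esub>} \<or> U = carrier Q"
  proof (cases "U' \<subseteq> N")
    case True
    then have "U \<subseteq> {N}" using U_eq coset_absorb by auto
    then show ?thesis using \<open>U \<noteq> {}\<close> by (auto simp: quot_space_def)
  next
    case False
    have "U' = carrier M"
    proof (rule irr)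
      show "submodule U' CC M" unfolding U'_def by (rule submodule_preimage) (use U in simp)
      show "\<rho> g x \<in> U'" if "g \<in> carrier G" "x \<in> U'" for g x
      proof -
        have "quot_action M N \<rho> g (coset x) \<in> U" using U that by (auto simp: U'_def)
        then show ?thesis
          using that by (simp add: U'_def quot_action_def carrier_Q image_coset act_closed)
      qed
    qed fact
    then show ?thesis using U_eq by (simp add: carrier_Q)
  qed
qed

end

section \<open>Half trees\<close>

lemma simple_graph_edgeD:
  assumes "simple_graph G" "{a, b} \<in> edges G"
  shows "a \<in> vertices G" "b \<in> vertices G" "a \<noteq> b"
  using assms by (force simp: simple_graph_def doubleton_eq_iff)+

section \<open>Walks, distances and geodesics\<close>

lemma walk_Cons:
  "walk G (a # xs) \<longleftrightarrow>
    a \<in> vertices G \<and> (xs = [] \<or> {a, hd xs} \<in> edges G \<and> walk G xs)"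
  by (cases xs) (auto simp: walk_def)

lemma walk_rev: "walk G (rev xs) \<longleftrightarrow> walk G xs"
  by (simp add: walk_def successively_rev insert_commute)

lemma graph_dist_le: "walk G xs \<Longrightarrow> length xs = Suc n \<Longrightarrow> graph_dist G (hd xs) (last xs) \<le> n"
  unfolding graph_dist_def by (rule Least_le) blast

lemma graph_dist_self: "a \<in> vertices G \<Longrightarrow> graph_dist G a a = 0"
  using graph_dist_le[of G "[a]" 0] by (simp add: walk_def)

lemma graph_dist_walk:
  assumes "connected_graph G" "a \<in> vertices G" "z \<in> vertices G"
  obtains xs where "walk G xs" "hd xs = a" "last xs = z" "length xs = Suc (graph_dist G a z)"
proof -
  obtain xs where "walk G xs" "hd xs = a" "last xs = z"
    using assms unfolding connected_graph_def by blast
  moreover from this(1) have "length xs = Suc (length xs - 1)" by (cases xs) (auto simp: walk_def)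
  ultimately have "\<exists>n xs. walk G xs \<and> hd xs = a \<and> last xs = z \<and> length xs = Suc n" by blast
  from LeastI_ex[OF this] show ?thesis using that unfolding graph_dist_def by blast
qed

lemma graph_dist_eq_0:
  assumes "connected_graph G" "a \<in> vertices G" "z \<in> vertices G" "graph_dist G a z = 0"
  shows "a = z"
  using graph_dist_walk[OF assms(1-3)] assms(4) by (metis One_nat_def last_ConsL length_0_conv length_Suc_conv list.sel(1))

lemma graph_dist_edge:
  assumes "simple_graph G" "connected_graph G" "{a, b} \<in> edges G" "z \<in> vertices G"
  shows "graph_dist G a z \<le> Suc (graph_dist G b z)"
proof -
  note ab = simple_graph_edgeD[OF assms(1,3)]
  obtain xs where "walk G xs" "hd xs = b" "last xs = z" "length xs = Suc (graph_dist G b z)"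
    using graph_dist_walk[OF assms(2) ab(2) assms(4)] .
  moreover from this have "walk G (a # xs)" "xs \<noteq> []" using ab assms(3) by (auto simp: walk_Cons)
  ultimately show ?thesis using graph_dist_le[of G "a # xs"] by simp
qed

lemma graph_dist_Suc:
  assumes "simple_graph G" "connected_graph G" "a \<in> vertices G" "z \<in> vertices G"
    and "graph_dist G a z = Suc n"
  obtains c where "{a, c} \<in> edges G" "graph_dist G c z = n"
proof -
  obtain xs where xs: "walk G xs" "hd xs = a" "last xs = z" "length xs = Suc (Suc n)"
    using graph_dist_walk[OF assms(2-4)] assms(5) by metis
  then obtain ys where ys: "xs = a # ys" by (cases xs) auto
  with xs have *: "ys \<noteq> []" "{a, hd ys} \<in> edges G" "walk G ys" "last ys = z" "length ys = Suc n"
    by (auto simp: walk_Cons)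
  then have "graph_dist G (hd ys) z \<le> n" using graph_dist_le by blast
  moreover have "Suc n \<le> Suc (graph_dist G (hd ys) z)"
    using graph_dist_edge[OF assms(1,2) *(2) assms(4)] assms(5) by simp
  ultimately show ?thesis using that *(2) by simp
qed

text \<open>The path approaches \<open>z\<close> by one in every step, so its part from
  \<open>a\<close> to \<open>c\<close> has \<open>graph_dist G a z - graph_dist G c z\<close> edges.
  The last property is the triangle inequality for this part: the distance to \<open>w\<close>
  cannot change by more than its length.\<close>

lemma graph_dist_path:
  assumes "simple_graph G" "connected_graph G" "a \<in> vertices G" "z \<in> vertices G"
  obtains xs where "walk G xs" "hd xs = a" "last xs = z" "distinct xs"
    and "\<And>c w. c \<in> set xs \<Longrightarrow> w \<in> vertices G \<Longrightarrow>
      graph_dist G a w + graph_dist G c z \<le> graph_dist G c w + graph_dist G a z"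
proof -
  have "\<exists>xs. walk G xs \<and> hd xs = a \<and> last xs = z \<and> distinct xs \<and>
      (\<forall>c\<in>set xs. graph_dist G c z \<le> n \<and>
        (\<forall>w\<in>vertices G. graph_dist G a w + graph_dist G c z \<le> graph_dist G c w + n))"
    if "graph_dist G a z = n" "a \<in> vertices G" for n a
    using that
  proof (induction n arbitrary: a)
    case 0
    then have "a = z" using graph_dist_eq_0 assms by metis
    then show ?case using 0 by (intro exI[of _ "[a]"]) (auto simp: walk_def)
  next
    case (Suc n)
    obtain c where c: "{a, c} \<in> edges G" "graph_dist G c z = n"
      using graph_dist_Suc[OF assms(1,2) Suc.prems(2) assms(4) Suc.prems(1)] .
    then have "c \<in> vertices G" using simple_graph_edgeD[OF assms(1)] by metis
    from Suc.IH[OF c(2) this] obtain xs where xs: "walk G xs" "hd xs = c" "last xs = z" "distinct xs"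
      and xs': "\<And>d. d \<in> set xs \<Longrightarrow> graph_dist G d z \<le> n"
        "\<And>d w. d \<in> set xs \<Longrightarrow> w \<in> vertices G \<Longrightarrow>
          graph_dist G c w + graph_dist G d z \<le> graph_dist G d w + n"
      by blast
    \<comment> \<open>All vertices of \<open>xs\<close> have distance at most \<open>n\<close> from
      \<open>z\<close>, whereas \<open>a\<close> has distance \<open>Suc n\<close>.\<close>
    have "a \<notin> set xs" using xs'(1)[of a] Suc.prems(1) by auto
    moreover have "xs \<noteq> []" using xs(1) by (simp add: walk_def)
    moreover have "graph_dist G a w + graph_dist G d z \<le> graph_dist G d w + Suc n"
      if "d \<in> set xs" "w \<in> vertices G" for d w
      using xs'(2)[OF that] graph_dist_edge[OF assms(1,2) c(1) that(2)] by simp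
    ultimately show ?case
      using xs xs'(1) c(1) Suc.prems
      by (intro exI[of _ "a # xs"]) (auto simp: walk_Cons intro: le_SucI)
  qed
  then show ?thesis using assms that by metis
qed

text \<open>The first step of a geodesic to \<open>z\<close> lowers the distance to \<open>z\<close>
  by exactly one and the distance to \<open>w\<close> by at most one, so \<open>z\<close> stays the
  nearer end.\<close>

lemma half_tree_step:
  assumes "simple_graph G" "connected_graph G" "z \<in> vertices G" "w \<in> vertices G"
    and a: "a \<in> half_tree G z w" "a \<noteq> z"
  obtains c where "{a, c} \<in> edges G" "c \<in> half_tree G z w" "graph_dist G c z < graph_dist G a z"
proof -
  have a': "a \<in> vertices G" "graph_dist G a z < graph_dist G a w"
    using a by (auto simp: half_tree_def)
  then have "graph_dist G a z \<noteq> 0" using graph_dist_eq_0 assms by metis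
  then obtain n where n: "graph_dist G a z = Suc n" using not0_implies_Suc by blast
  obtain c where c: "{a, c} \<in> edges G" "graph_dist G c z = n"
    using graph_dist_Suc[OF assms(1,2) a'(1) assms(3) n] .
  have "c \<in> half_tree G z w"
    using graph_dist_edge[OF assms(1,2) c(1) assms(4)] c a'(2) n simple_graph_edgeD[OF assms(1) c(1)]
    by (auto simp: half_tree_def)
  then show ?thesis using that c n by simp
qed

text \<open>
  Otherwise the geodesics from \<open>a\<close> to \<open>z\<close> and from \<open>b\<close> to \<open>w\<close>, which lie on different sides,
  form a circuit together with the edges \<open>{a, b}\<close> and \<open>{z, w}\<close>.
\<close>

lemma half_tree_boundary:
  assumes G: "tree_graph G" and zw: "{z, w} \<in> edges G" and ab: "{a, b} \<in> edges G"
    and a: "a \<in> half_tree G z w" and b: "b \<notin> half_tree G z w"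
  shows "a = z \<and> b = w"
proof (rule ccontr)
  assume neq: "\<not> (a = z \<and> b = w)"
  have G': "simple_graph G" "connected_graph G" using G by (simp_all add: tree_graph_def)
  note zw' = simple_graph_edgeD[OF G'(1) zw] and ab' = simple_graph_edgeD[OF G'(1) ab]
  obtain xs where xs: "walk G xs" "hd xs = a" "last xs = z" "distinct xs"
    "\<And>c w. c \<in> set xs \<Longrightarrow> w \<in> vertices G \<Longrightarrow>
      graph_dist G a w + graph_dist G c z \<le> graph_dist G c w + graph_dist G a z"
    using graph_dist_path[OF G' ab'(1) zw'(1)] by blast
  obtain ys where ys: "walk G ys" "hd ys = b" "last ys = w" "distinct ys"
    "\<And>c v. c \<in> set ys \<Longrightarrow> v \<in> vertices G \<Longrightarrow>
      graph_dist G b v + graph_dist G c w \<le> graph_dist G c v + graph_dist G b w"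
    using graph_dist_path[OF G' ab'(2) zw'(2)] by blast
  have a': "graph_dist G a z < graph_dist G a w" and b': "graph_dist G b w \<le> graph_dist G b z"
    using a b ab' by (auto simp: half_tree_def)
  have "set xs \<inter> set ys = {}"
  proof (intro equals0I)
    fix c assume "c \<in> set xs \<inter> set ys"
    \<comment> \<open>The inequality along \<open>xs\<close> makes \<open>c\<close> strictly nearer
      to \<open>z\<close> than to \<open>w\<close>; the one along \<open>ys\<close> makes it at
      least as near to \<open>w\<close> as to \<open>z\<close>.\<close>
    then show False using xs(5)[of c w] ys(5)[of c z] zw' a' b' by auto
  qed
  moreover have ne: "xs \<noteq> []" "ys \<noteq> []" using xs(1) ys(1) by (auto simp: walk_def)
  moreover have "walk G (rev xs @ ys)"
    using xs(1,2) ys(1,2) ab ne walk_rev[of G xs]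
    by (auto simp: walk_def successively_append_iff last_rev)
  \<comment> \<open>With only two vertices both paths would be single points, which is the case
    excluded by \<open>neq\<close>.\<close>
  moreover have "3 \<le> length (rev xs @ ys)"
  proof (rule ccontr)
    assume "\<not> 3 \<le> length (rev xs @ ys)"
    moreover have "length xs \<ge> 1" "length ys \<ge> 1" using ne by (auto simp: Suc_le_eq)
    ultimately have "length xs = 1" "length ys = 1" by auto
    then obtain x y where "xs = [x]" "ys = [y]" by (auto simp: length_Suc_conv)
    then show False using xs(2,3) ys(2,3) neq by simp
  qed
  ultimately have "circuit G (rev xs @ ys)"
    using xs(3,4) ys(3,4) zw by (auto simp: circuit_def hd_rev insert_commute)
  then show False using G by (auto simp: tree_graph_def)
qed

section \<open>Free spaces\<close>

lemma free_space_simps [simp]: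
  "\<zero>\<^bsub>free_space A\<^esub> = (\<lambda>_. 0)"
  "v \<oplus>\<^bsub>free_space A\<^esub> w = (\<lambda>a. v a + w a)"
  "c \<odot>\<^bsub>free_space A\<^esub> v = (\<lambda>a. c * v a)"
  by (simp_all add: free_space_def)

lemma carrier_free_space:
  "v \<in> carrier (free_space A) \<longleftrightarrow> finite {a. v a \<noteq> 0} \<and> (\<forall>a. v a \<noteq> 0 \<longrightarrow> a \<in> A)"
  by (auto simp: free_space_def)

lemma free_space_zeroD: "v \<in> carrier (free_space A) \<Longrightarrow> a \<notin> A \<Longrightarrow> v a = 0"
  by (auto simp: carrier_free_space)

lemma free_space_zero_closed: "(\<lambda>_. 0) \<in> carrier (free_space A)"
  by (simp add: carrier_free_space)

lemma free_space_add_closed: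
  assumes "v \<in> carrier (free_space A)" "w \<in> carrier (free_space A)"
  shows "(\<lambda>a. v a + w a) \<in> carrier (free_space A)"
proof -
  have "{a. v a + w a \<noteq> 0} \<subseteq> {a. v a \<noteq> 0} \<union> {a. w a \<noteq> 0}" by auto
  moreover have "finite ({a. v a \<noteq> 0} \<union> {a. w a \<noteq> 0})"
    using assms by (simp add: carrier_free_space)
  ultimately have "finite {a. v a + w a \<noteq> 0}" by (rule finite_subset)
  then show ?thesis using assms unfolding carrier_free_space by (metis add_0)
qed

lemma free_space_smult_closed:
  assumes "v \<in> carrier (free_space A)"
  shows "(\<lambda>a. c * v a) \<in> carrier (free_space A)"
  using assms by (cases "c = 0") (auto simp: carrier_free_space)

lemma free_space_diff_closed:
  assumes "v \<in> carrier (free_space A)" "w \<in> carrier (free_space A)"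
  shows "(\<lambda>a. v a - w a) \<in> carrier (free_space A)"
  using free_space_add_closed[OF assms(1) free_space_smult_closed[OF assms(2), of "-1"]] by simp

lemma free_space_mono: "B \<subseteq> A \<Longrightarrow> carrier (free_space B) \<subseteq> carrier (free_space A)"
  unfolding subset_iff carrier_free_space by blast

lemma basis_vec_closed: "a \<in> A \<Longrightarrow> basis_vec a \<in> carrier (free_space A)"
  by (auto simp: carrier_free_space basis_vec_def)

lemma module_free_space: "Module.module CC (free_space A)"
proof (rule moduleI)
  show "abelian_group (free_space A)"
  proof (rule abelian_groupI)
    fix v assume v: "v \<in> carrier (free_space A)"
    show "\<exists>w\<in>carrier (free_space A). w \<oplus>\<^bsub>free_space A\<^esub> v = \<zero>\<^bsub>free_space A\<^esub>"
      using free_space_smult_closed[OF v, of "-1"] by (intro bexI) (auto simp: fun_eq_iff)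
  qed (auto intro: free_space_add_closed free_space_zero_closed simp: algebra_simps)
qed (auto intro: CC_cring free_space_smult_closed simp: algebra_simps)

lemma free_space_minus:
  "v \<in> carrier (free_space A) \<Longrightarrow> \<ominus>\<^bsub>free_space A\<^esub> v = (\<lambda>a. - v a)"
  using module_minus[OF module_free_space, of v A] by simp

text \<open>Induction over a finite set that contains the support: the coefficient at one point
  \<open>a\<close> is split off, and \<open>v(a := 0)\<close> has its support in the smaller
  set.\<close>

lemma free_space_induct [consumes 1, case_names zero add]:
  assumes "v \<in> carrier (free_space A)"
    and zero: "P (\<lambda>_. 0)"
    and add: "\<And>v a c. v \<in> carrier (free_space A) \<Longrightarrow> a \<in> A \<Longrightarrow> P v \<Longrightarrow>
      P (\<lambda>b. v b + c * basis_vec a b)"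
  shows "P v"
proof -
  have "P v" if "finite F" "\<And>a. v a \<noteq> 0 \<Longrightarrow> a \<in> F" "F \<subseteq> A" for F and v :: "'a \<Rightarrow> complex"
    using that
  proof (induction F arbitrary: v)
    case empty
    then have "v = (\<lambda>_. 0)" by auto
    then show ?case using zero by simp
  next
    case (insert a F)
    have v: "v = (\<lambda>b. (v(a := 0)) b + v a * basis_vec a b)"
      by (auto simp: basis_vec_def)
    have "{b. (v(a := 0)) b \<noteq> 0} \<subseteq> F" using insert.prems(1) by auto
    then have "v(a := 0) \<in> carrier (free_space A)"
      using insert.prems(2) finite_subset[OF _ insert.hyps(1)]
      unfolding carrier_free_space by blast
    moreover have "P (v(a := 0))"
      using insert.prems by (intro insert.IH) (auto split: if_splits)
    ultimately have "P (\<lambda>b. (v(a := 0)) b + v a * basis_vec a b)"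
      using insert.prems(2) by (intro add[of "v(a := 0)"]) simp_all
    then show ?case using v by simp
  qed
  from this[of "{a. v a \<noteq> 0}" v] show ?thesis using assms(1) by (auto simp: carrier_free_space)
qed

lemma free_space_subset_submodule:
  assumes U: "submodule U CC (free_space A)" and B: "\<And>a. a \<in> B \<Longrightarrow> basis_vec a \<in> U"
  shows "carrier (free_space B) \<subseteq> U"
proof
  note U' = module.submoduleE[OF module_free_space U]
  fix v :: "'a \<Rightarrow> complex" assume "v \<in> carrier (free_space B)"
  then show "v \<in> U"
  proof (induction rule: free_space_induct)
    case zero
    show ?case
      using submodule_zero[OF U] by simp
  next
    case (add v a c)
    then show ?case using U'(4)[of c "basis_vec a"] U'(5)[of v] B by simp
  qed
qed

text \<open>Replaces the hull that defines \<open>V1\<close> by a condition on supports.\<close>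

lemma lin_span_basis_vec:
  assumes "B \<subseteq> A"
  shows "lin_span (free_space A) (basis_vec ` B) = carrier (free_space B)"
  unfolding lin_span_def
proof (rule hull_unique)
  show "submodule (carrier (free_space B)) CC (free_space A)"
    using assms
    by (intro submodule_CC_I module_free_space)
      (auto intro: free_space_add_closed free_space_smult_closed free_space_zero_closed
        dest: subsetD[OF free_space_mono])
  show "carrier (free_space B) \<subseteq> U"
    if "basis_vec ` B \<subseteq> U" "submodule U CC (free_space A)" for U
    using that by (intro free_space_subset_submodule[OF that(2)]) blast
qed (auto intro: basis_vec_closed)

text \<open>Only the carrier of \<open>free_space A\<close> depends on \<open>A\<close>. So the
  subspace \<open>V1\<close>, taken as a space of its own, is literally the free space on the half
  tree.\<close>

lemma free_space_update: "free_space A\<lparr>carrier := carrier (free_space B)\<rparr> = free_space B"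
  by (simp add: free_space_def)

text \<open>The linear map \<open>\<phi>\<close> vanishes on \<open>N\<close>, hence is constant on
  cosets. Representatives of finitely many generators involve only a finite set \<open>F\<close> of
  coordinates under \<open>\<phi>\<close>, and so does everything they span, although infinitely
  many coordinates occur on \<open>M\<close>.\<close>

lemma (in module_quotient) infinite_dim_Q:
  fixes \<phi> :: "'v \<Rightarrow> 'b \<Rightarrow> complex"
  assumes add: "\<And>x y. x \<in> carrier M \<Longrightarrow> y \<in> carrier M \<Longrightarrow> \<phi> (x \<oplus>\<^bsub>M\<^esub> y) = (\<lambda>b. \<phi> x b + \<phi> y b)"
    and smult: "\<And>c x. x \<in> carrier M \<Longrightarrow> \<phi> (c \<odot>\<^bsub>M\<^esub> x) = (\<lambda>b. c * \<phi> x b)"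
    and zero: "\<And>x. x \<in> N \<Longrightarrow> \<phi> x = (\<lambda>_. 0)"
    and fin: "\<And>x. x \<in> carrier M \<Longrightarrow> finite {b. \<phi> x b \<noteq> 0}"
    and inf: "infinite {b. \<exists>x\<in>carrier M. \<phi> x b \<noteq> 0}"
  shows "infinite_dim Q"
  unfolding infinite_dim_def
proof
  assume "\<exists>B. finite B \<and> B \<subseteq> carrier Q \<and> lin_span Q B = carrier Q"
  then obtain B where B: "finite B" "B \<subseteq> carrier Q" "lin_span Q B = carrier Q" by blast
  have "\<forall>K\<in>B. \<exists>x\<in>carrier M. K = coset x" using B(2) unfolding carrier_Q by blast
  then obtain r where r: "\<And>K. K \<in> B \<Longrightarrow> r K \<in> carrier M" "\<And>K. K \<in> B \<Longrightarrow> K = coset (r K)"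
    by metis
  define F where "F = (\<Union>K\<in>B. {b. \<phi> (r K) b \<noteq> 0})"
  have "finite F" unfolding F_def using B(1) fin r(1) by blast
  define U where "U = {x \<in> carrier M. \<forall>b. \<phi> x b \<noteq> 0 \<longrightarrow> b \<in> F}"
  have "submodule U CC M"
  proof (rule submodule_CC_I[OF module_axioms])
    have "\<zero>\<^bsub>M\<^esub> \<in> N" by simp
    then show "\<zero>\<^bsub>M\<^esub> \<in> U" using zero unfolding U_def by simp
    show "x \<oplus>\<^bsub>M\<^esub> y \<in> U" if "x \<in> U" "y \<in> U" for x y
      using that add[of x y] unfolding U_def by auto (metis add_0)
    show "c \<odot>\<^bsub>M\<^esub> x \<in> U" if "x \<in> U" for c x
      using that smult[of x c] unfolding U_def by auto
  qed (auto simp: U_def)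
  from submodule_image[OF this] have "lin_span Q B \<subseteq> coset ` U"
    unfolding lin_span_def
  proof (rule hull_minimal[rotated])
    show "B \<subseteq> coset ` U"
    proof
      fix K assume "K \<in> B"
      then have "r K \<in> U" using r(1) unfolding U_def F_def by blast
      then show "K \<in> coset ` U" using r(2)[OF \<open>K \<in> B\<close>] by blast
    qed
  qed
  have "b \<in> F" if x: "x \<in> carrier M" and b: "\<phi> x b \<noteq> 0" for x b
  proof -
    have "coset x \<in> coset ` U"
      using x B(3) \<open>lin_span Q B \<subseteq> coset ` U\<close> unfolding carrier_Q by blast
    then obtain u where u: "u \<in> U" "coset x = coset u" by blast
    then have u': "u \<in> carrier M" by (simp add: U_def)
    obtain n where n: "n \<in> N" "x = n \<oplus>\<^bsub>M\<^esub> u" using coset_eqD[OF u(2) x u'] .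
    have "n \<in> carrier M" using n(1) N_subset by blast
    then have "\<phi> x = \<phi> u" using add[of n u] zero[OF n(1)] n(2) u' by simp
    then show ?thesis using u(1) b by (simp add: U_def)
  qed
  then have "{b. \<exists>x\<in>carrier M. \<phi> x b \<noteq> 0} \<subseteq> F" by blast
  then show False using inf \<open>finite F\<close> finite_subset by blast
qed


section \<open>Weighted reflections along a covering\<close>

text \<open>
  \<open>N\<close> is the adjacency relation of the covering graph and \<open>k a b\<close> is the coefficient of
  \<open>\<alpha>\<^sub>b\<close> in \<open>p b \<cdot> \<alpha>\<^sub>a\<close>.
\<close>

locale covering_reflections =
  fixes A :: "'b set" and S :: "'w set" and p :: "'b \<Rightarrow> 'w" and N :: "'b \<Rightarrow> 'b \<Rightarrow> bool"
    and k :: "'b \<Rightarrow> 'b \<Rightarrow> complex" and \<sigma> :: "'w \<Rightarrow> ('b \<Rightarrow> complex) \<Rightarrow> 'b \<Rightarrow> complex"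
  assumes closed: "s \<in> S \<Longrightarrow> v \<in> carrier (free_space A) \<Longrightarrow> \<sigma> s v \<in> carrier (free_space A)"
    and add: "s \<in> S \<Longrightarrow> v \<in> carrier (free_space A) \<Longrightarrow> w \<in> carrier (free_space A) \<Longrightarrow>
      \<sigma> s (\<lambda>a. v a + w a) = (\<lambda>a. \<sigma> s v a + \<sigma> s w a)"
    and smult: "s \<in> S \<Longrightarrow> v \<in> carrier (free_space A) \<Longrightarrow> \<sigma> s (\<lambda>a. z * v a) = (\<lambda>a. z * \<sigma> s v a)"
    and p_mem: "a \<in> A \<Longrightarrow> p a \<in> S"
    and N_mem: "N a b \<Longrightarrow> a \<in> A"
    and N_sym: "N a b \<Longrightarrow> N b a"
    and N_neq: "N a b \<Longrightarrow> p a \<noteq> p b"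
    and N_unique: "N a b \<Longrightarrow> N a c \<Longrightarrow> p b = p c \<Longrightarrow> b = c"
    and N_lift: "N a b \<Longrightarrow> a' \<in> A \<Longrightarrow> p a' = p a \<Longrightarrow> \<exists>b'. N a' b' \<and> p b' = p b"
    and gen_neg: "a \<in> A \<Longrightarrow> \<sigma> (p a) (basis_vec a) = (\<lambda>b. - basis_vec a b)"
    and gen_edge: "N a b \<Longrightarrow> \<sigma> (p b) (basis_vec a) = (\<lambda>c. basis_vec a c + k a b * basis_vec b c)"
    and gen_fix: "s \<in> S \<Longrightarrow> a \<in> A \<Longrightarrow> s \<noteq> p a \<Longrightarrow> (\<And>b. N a b \<Longrightarrow> p b \<noteq> s) \<Longrightarrow>
      \<sigma> s (basis_vec a) = basis_vec a"
begin

definition fibre :: "'w \<Rightarrow> 'b set" where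
  "fibre s = {a \<in> A. p a = s}"

definition shift :: "'w \<Rightarrow> ('b \<Rightarrow> complex) \<Rightarrow> 'b \<Rightarrow> complex" where
  "shift s v = (\<lambda>a. \<sigma> s v a - v a)"

lemma p_target_mem: "N a b \<Longrightarrow> p b \<in> S"
  by (rule p_mem[OF N_mem[OF N_sym]])

lemma fibre_subset: "v \<in> carrier (free_space (fibre s)) \<Longrightarrow> v \<in> carrier (free_space A)"
  using free_space_mono[of "fibre s" A] by (auto simp: fibre_def)

lemma act_zero: "s \<in> S \<Longrightarrow> \<sigma> s (\<lambda>_. 0) = (\<lambda>_. 0)"
  using smult[OF _ free_space_zero_closed, of s 0] by simp

lemma act_add_basis:
  assumes "s \<in> S" "v \<in> carrier (free_space A)" "a \<in> A"
  shows "\<sigma> s (\<lambda>b. v b + c * basis_vec a b) = (\<lambda>b. \<sigma> s v b + c * \<sigma> s (basis_vec a) b)"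
  using add[OF assms(1,2) free_space_smult_closed[OF basis_vec_closed[OF assms(3)], of c]]
    smult[OF assms(1) basis_vec_closed[OF assms(3)], of c] by simp

lemma gen_cases:
  assumes "s \<in> S" "a \<in> A"
  obtains "s = p a" | b where "N a b" "p b = s" | "\<sigma> s (basis_vec a) = basis_vec a"
  using gen_fix[OF assms] by blast

text \<open>On basis vectors, \<open>\<sigma> s - 1\<close> produces only multiples of basis vectors
  over \<open>s\<close>.\<close>

lemma act_outside_fibre:
  assumes "v \<in> carrier (free_space A)" "s \<in> S" "p b \<noteq> s"
  shows "\<sigma> s v b = v b"
  using assms(1)
proof (induction rule: free_space_induct)
  case zero
  show ?case using act_zero assms(2) by simp
next
  case (add v a c)
  have "\<sigma> s (basis_vec a) b = basis_vec a b"
  proof (rule gen_cases[OF assms(2) add.hyps(2)])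
    assume "s = p a"
    then show ?thesis
      using gen_neg[OF add.hyps(2)] assms(3) by (auto simp: basis_vec_def)
  next
    fix d assume "N a d" "p d = s"
    then show ?thesis using gen_edge[of a d] assms(3) by (auto simp: basis_vec_def)
  qed simp
  then show ?case using act_add_basis[OF assms(2) add.hyps] add.IH by simp
qed

text \<open>By lifting, each \<open>a'\<close> over \<open>p a\<close> has a neighbour over
  \<open>p b\<close>, so the edge rule describes the action on the whole fibre. By uniqueness only
  \<open>a' = a\<close> has \<open>b\<close> as this neighbour, so no other term reaches the
  coordinate \<open>b\<close>.\<close>

lemma act_edge:
  assumes "v \<in> carrier (free_space (fibre (p a)))" "N a b"
  shows "\<sigma> (p b) v b = k a b * v a"
  using assms(1)
proof (induction rule: free_space_induct)
  have b: "p b \<in> S" by (rule p_target_mem[OF assms(2)])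
  {
    case zero
    show ?case using act_zero b by simp
  next
    case (add v a' c)
    then have a': "a' \<in> A" "p a' = p a" by (auto simp: fibre_def)
    obtain b' where b': "N a' b'" "p b' = p b" using N_lift[OF assms(2) a'] by blast
    have "\<sigma> (p b) (basis_vec a') b = k a b * basis_vec a' a"
    proof (cases "a' = a")
      case True
      then show ?thesis
        using gen_edge[OF assms(2)] N_neq[OF assms(2)] by (auto simp: basis_vec_def)
    next
      case False
      then have "b \<noteq> b'" using N_unique[OF N_sym[OF b'(1)], of a] N_sym[OF assms(2)] a' by auto
      moreover have "b \<noteq> a'" using N_neq[OF assms(2)] a' by auto
      ultimately show ?thesis using gen_edge[OF b'(1)] b'(2) False by (auto simp: basis_vec_def)
    qed
    then show ?case
      using act_add_basis[OF b fibre_subset[OF add.hyps(1)] a'(1)] add.IH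
      by (simp add: algebra_simps)
  }
qed

lemma shift_closed:
  assumes "v \<in> carrier (free_space A)" "s \<in> S"
  shows "shift s v \<in> carrier (free_space (fibre s))"
proof -
  have "shift s v \<in> carrier (free_space A)"
    unfolding shift_def by (rule free_space_diff_closed[OF closed[OF assms(2,1)] assms(1)])
  moreover have "p a = s" if "shift s v a \<noteq> 0" for a
    using act_outside_fibre[OF assms, of a] that by (cases "p a = s") (simp_all add: shift_def)
  ultimately show ?thesis by (auto simp: carrier_free_space fibre_def)
qed

lemma shift_edge:
  assumes "v \<in> carrier (free_space (fibre (p a)))" "N a b"
  shows "shift (p b) v b = k a b * v a"
  using act_edge[OF assms] free_space_zeroD[OF assms(1), of b] N_neq[OF assms(2)]
  by (simp add: shift_def fibre_def)

text \<open>A basis vector can leave \<open>H\<close> only along an edge out of \<open>H\<close>,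
  where the coefficient vanishes. For the half tree this is the situation of order 4.\<close>

lemma act_closed_subset:
  assumes "H \<subseteq> A" "s \<in> S" "v \<in> carrier (free_space H)"
    and H: "\<And>a b. a \<in> H \<Longrightarrow> N a b \<Longrightarrow> b \<notin> H \<Longrightarrow> k a b = 0"
  shows "\<sigma> s v \<in> carrier (free_space H)"
  using assms(3)
proof (induction rule: free_space_induct)
  case zero
  show ?case using act_zero assms(2) free_space_zero_closed by simp
next
  case (add v a c)
  have a: "a \<in> A" using add.hyps(2) assms(1) by blast
  have "\<sigma> s (basis_vec a) \<in> carrier (free_space H)"
  proof (rule gen_cases[OF assms(2) a])
    assume "s = p a"
    then show ?thesis
      using gen_neg[OF a] free_space_smult_closed[OF basis_vec_closed[OF add.hyps(2)], of "-1"]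
      by simp
  next
    fix b assume b: "N a b" "p b = s"
    have "(\<lambda>c. k a b * basis_vec b c) \<in> carrier (free_space H)"
      using H[OF add.hyps(2) b(1)] free_space_smult_closed[OF basis_vec_closed, of b H]
        free_space_zero_closed by (cases "b \<in> H") auto
    from free_space_add_closed[OF basis_vec_closed[OF add.hyps(2)] this] show ?thesis
      using gen_edge[OF b(1)] b(2) by simp
  next
    assume "\<sigma> s (basis_vec a) = basis_vec a"
    then show ?thesis using basis_vec_closed[OF add.hyps(2)] by simp
  qed
  from free_space_add_closed[OF add.IH free_space_smult_closed[OF this, of c]]
  show ?case
    using act_add_basis[OF assms(2) _ a] add.hyps(1) free_space_mono[OF assms(1)] by auto
qed

text \<open>
  The two shifts along the edges over \<open>p a1, p a2\<close> multiply \<open>\<alpha>\<^sub>a\<close> by \<open>k a b * k b a\<close>, which is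
  \<open>c\<close> on the fibre except at \<open>a1\<close>; subtracting \<open>c\<close> times the vector isolates the basis vector of \<open>a1\<close>.
\<close>

lemma invariant_subspace_full:
  assumes U: "submodule U CC (free_space A)" and inv: "\<And>s v. s \<in> S \<Longrightarrow> v \<in> U \<Longrightarrow> \<sigma> s v \<in> U"
    and UH: "U \<subseteq> carrier (free_space H)"
    and a12: "N a1 a2" and c: "k a1 a2 * k a2 a1 \<noteq> c"
    and generic: "\<And>a b. N a b \<Longrightarrow> p a = p a1 \<Longrightarrow> p b = p a2 \<Longrightarrow> a \<noteq> a1 \<Longrightarrow> k a b * k b a = c"
    and conn: "\<And>a. a \<in> H \<Longrightarrow> (\<lambda>a b. N a b \<and> k a b \<noteq> 0 \<and> k b a \<noteq> 0)\<^sup>*\<^sup>* a a1"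
    and v: "v \<in> U" "s \<in> S" "\<sigma> s v \<noteq> v"
  shows "carrier (free_space H) \<subseteq> U"
proof (rule free_space_subset_submodule[OF U])
  note U' = module.submoduleE[OF module_free_space U]
  have U_A: "w \<in> carrier (free_space A)" if "w \<in> U" for w using U'(1) that by blast
  have U_add: "(\<lambda>a. x a + y a) \<in> U" if "x \<in> U" "y \<in> U" for x y using U'(5)[OF that] by simp
  have U_smult: "(\<lambda>a. d * x a) \<in> U" if "x \<in> U" for d x using U'(4)[of d x] that by simp
  have U_diff: "(\<lambda>a. x a - y a) \<in> U" if "x \<in> U" "y \<in> U" for x y
    using U_add[OF that(1) U_smult[OF that(2), of "-1"]] by simp
  have U_shift: "shift t w \<in> U" if "w \<in> U" "t \<in> S" for t w
    unfolding shift_def by (rule U_diff[OF inv[OF that(2,1)] that(1)])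
  \<comment> \<open>Both coefficients are required to be nonzero because chains are used in both
    directions: towards \<open>a1\<close> to carry a nonzero coordinate there, and away from
    \<open>a1\<close> to spread basis vectors.\<close>
  define R where "R = (\<lambda>a b. N a b \<and> k a b \<noteq> 0 \<and> k b a \<noteq> 0)"
  have move: "\<exists>w\<in>U. w \<in> carrier (free_space (fibre (p b))) \<and> w b \<noteq> 0"
    if "R\<^sup>*\<^sup>* a b" "w \<in> U" "w \<in> carrier (free_space (fibre (p a)))" "w a \<noteq> 0" for a b w
    using that(1)
  proof (induction rule: rtranclp_induct)
    case base
    then show ?case using that by blast
  next
    case (step b d)
    then obtain w where w: "w \<in> U" "w \<in> carrier (free_space (fibre (p b)))" "w b \<noteq> 0" by blast
    have bd: "N b d" "k b d \<noteq> 0" using step.hyps(2) by (auto simp: R_def)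
    have "shift (p d) w d \<noteq> 0" using shift_edge[OF w(2) bd(1)] bd(2) w(3) by simp
    then show ?case
      using U_shift[OF w(1) p_target_mem[OF bd(1)]]
        shift_closed[OF U_A[OF w(1)] p_target_mem[OF bd(1)]] by blast
  qed
  obtain a where a: "shift s v a \<noteq> 0" using v(3) by (auto simp: shift_def)
  have sv: "shift s v \<in> U" "shift s v \<in> carrier (free_space (fibre s))"
    using U_shift[OF v(1,2)] shift_closed[OF U_A[OF v(1)] v(2)] by auto
  \<comment> \<open>The bound on \<open>U\<close> puts the starting point of the chain inside
    \<open>H\<close>, where \<open>conn\<close> is available.\<close>
  have "a \<in> H" using sv(1) UH a by (auto simp: carrier_free_space)
  moreover have "p a = s" using sv(2) a by (auto simp: carrier_free_space fibre_def)
  ultimately obtain w where w: "w \<in> U" "w \<in> carrier (free_space (fibre (p a1)))" "w a1 \<noteq> 0"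
    using move[of a a1 "shift s v"] conn sv a unfolding R_def by blast
  define w' where "w' = shift (p a1) (shift (p a2) w)"
  have a1: "a1 \<in> A" "p a1 \<in> S" "p a2 \<in> S"
    using N_mem[OF a12] p_mem p_target_mem[OF a12] by auto
  have w2: "shift (p a2) w \<in> U" "shift (p a2) w \<in> carrier (free_space (fibre (p a2)))"
    using U_shift[OF w(1) a1(3)] shift_closed[OF U_A[OF w(1)] a1(3)] by auto
  have w'U: "w' \<in> U" "w' \<in> carrier (free_space (fibre (p a1)))"
    using U_shift[OF w2(1) a1(2)] shift_closed[OF U_A[OF w2(1)] a1(2)] by (auto simp: w'_def)
  have w'_eq: "w' a = k a b * k b a * w a" if "N a b" "p a = p a1" "p b = p a2" for a b
    using shift_edge[of w a b] shift_edge[of "shift (p b) w" b a] that w w2 N_sym[OF that(1)]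
    by (simp add: w'_def)
  \<comment> \<open>The coordinate at \<open>a1\<close> that survives when \<open>c\<close> times
    \<open>w\<close> is subtracted from \<open>w'\<close>.\<close>
  define e where "e = (k a1 a2 * k a2 a1 - c) * w a1"
  have e: "e \<noteq> 0" using c w(3) by (simp add: e_def)
  have "w' a - c * w a = e * basis_vec a1 a" for a
  proof (cases "a \<in> fibre (p a1)")
    case True
    then have "a \<in> A" "p a = p a1" by (auto simp: fibre_def)
    from N_lift[OF a12 this] obtain b where b: "N a b" "p b = p a2" by blast
    show ?thesis
    proof (cases "a = a1")
      case True
      then have "b = a2" using N_unique[OF a12, of b] b by simp
      then show ?thesis
        using w'_eq[OF b(1) \<open>p a = p a1\<close> b(2)] True by (simp add: e_def basis_vec_def algebra_simps)
    next
      case False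
      then show ?thesis
        using w'_eq[OF b(1) \<open>p a = p a1\<close> b(2)] generic[OF b(1) \<open>p a = p a1\<close> b(2)]
        by (simp add: basis_vec_def)
    qed
  next
    case False
    moreover have "a \<noteq> a1" using False a1(1) by (auto simp: fibre_def)
    ultimately show ?thesis
      using free_space_zeroD[OF w(2)] free_space_zeroD[OF w'U(2)] by (simp add: basis_vec_def)
  qed
  then have "(\<lambda>a. e * basis_vec a1 a) \<in> U"
    using U_diff[OF w'U(1) U_smult[OF w(1), of c]] by simp
  from U_smult[OF this, of "inverse e"] have base: "basis_vec a1 \<in> U"
    using e by (simp flip: mult.assoc)
  fix a assume "a \<in> H"
  from conn[OF this] show "basis_vec a \<in> U"
  proof (induction rule: converse_rtranclp_induct)
    case base
    show ?case by fact
  next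
    case (step a b)
    then have ba: "N b a" "k b a \<noteq> 0" using N_sym by auto
    \<comment> \<open>Reflecting \<open>basis_vec b\<close> in \<open>p a\<close> adds just a
      nonzero multiple of \<open>basis_vec a\<close>, which the subtraction isolates.\<close>
    have "(\<lambda>d. \<sigma> (p a) (basis_vec b) d - basis_vec b d) \<in> U"
      using inv[OF p_target_mem[OF ba(1)] step.IH] step.IH by (rule U_diff)
    then have "(\<lambda>d. k b a * basis_vec a d) \<in> U" using gen_edge[OF ba(1)] by simp
    from U_smult[OF this, of "inverse (k b a)"] show ?case
      using ba(2) by (simp flip: mult.assoc)
  qed
qed

text \<open>\<open>shift s\<close> serves as the map \<open>\<phi>\<close> of
  \<open>infinite_dim_Q\<close>: it kills \<open>K\<close>, and it multiplies the basis vectors over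
  \<open>s\<close> by \<open>-2\<close>, so every point of an infinite set occurs as a
  coordinate.\<close>

lemma infinite_dim_quotient:
  assumes "H \<subseteq> A" "s \<in> S" "infinite {a \<in> H. p a = s}"
    and K: "submodule K CC (free_space H)" and fixed: "\<And>v. v \<in> K \<Longrightarrow> \<sigma> s v = v"
  shows "infinite_dim (quot_space (free_space H) K)"
proof -
  interpret module_quotient "free_space H" K
    by (intro module_quotient.intro module_quotient_axioms.intro module_free_space K)
  have HA: "v \<in> carrier (free_space A)" if "v \<in> carrier (free_space H)" for v
    using that free_space_mono[OF assms(1)] by blast
  show ?thesis
  proof (rule infinite_dim_Q[of "shift s"])
    show "finite {b. shift s v b \<noteq> 0}" if "v \<in> carrier (free_space H)" for v
      using shift_closed[OF HA[OF that] assms(2)] by (simp add: carrier_free_space)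
    have "shift s (basis_vec a) a \<noteq> 0" if "a \<in> H" "p a = s" for a
    proof -
      have "shift s (basis_vec a) a = - 2 * basis_vec a a"
        using gen_neg[of a] that assms(1) unfolding shift_def by (simp add: subset_iff)
      then show ?thesis by (simp add: basis_vec_def)
    qed
    then have "a \<in> {b. \<exists>v\<in>carrier (free_space H). shift s v b \<noteq> 0}"
      if "a \<in> {a \<in> H. p a = s}" for a
      using that basis_vec_closed[of a H] by blast
    then have "{a \<in> H. p a = s} \<subseteq> {b. \<exists>v\<in>carrier (free_space H). shift s v b \<noteq> 0}"
      by (rule subsetI)
    then show "infinite {b. \<exists>v\<in>carrier (free_space H). shift s v b \<noteq> 0}"
      using assms(3) by (rule infinite_super)
    show "shift s (v \<oplus>\<^bsub>free_space H\<^esub> w) = (\<lambda>b. shift s v b + shift s w b)"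
      if "v \<in> carrier (free_space H)" "w \<in> carrier (free_space H)" for v w
      using add[OF assms(2) HA[OF that(1)] HA[OF that(2)]] by (simp add: shift_def algebra_simps)
    show "shift s (c \<odot>\<^bsub>free_space H\<^esub> v) = (\<lambda>b. c * shift s v b)"
      if "v \<in> carrier (free_space H)" for v c
      using smult[OF assms(2) HA[OF that]] by (simp add: shift_def algebra_simps)
    show "shift s v = (\<lambda>_. 0)" if "v \<in> K" for v
      using fixed[OF that] by (simp add: shift_def)
  qed
qed

end

section \<open>Coxeter groups and the representation\<close>

text \<open>\<open>U\<close> is an arbitrary subset, not a subspace, so that a singleton can be used
  to treat fixed vectors.\<close>

lemma generate_invariant:
  assumes "linear_action M G \<rho>" and S: "S \<subseteq> carrier G"
    and inv: "\<And>s x. s \<in> S \<Longrightarrow> x \<in> U \<Longrightarrow> \<rho> s x \<in> U \<and> \<rho> (inv\<^bsub>G\<^esub> s) x \<in> U"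
    and U: "U \<subseteq> carrier M" and g: "g \<in> generate G S"
  shows "x \<in> U \<Longrightarrow> \<rho> g x \<in> U"
proof -
  interpret linear_action M G \<rho> by fact
  interpret G: group G by (rule group)
  show "x \<in> U \<Longrightarrow> \<rho> g x \<in> U" using g
  proof (induction arbitrary: x rule: generate.induct)
    case one
    then show ?case using act_one U by auto
  next
    case (eng g h)
    then show ?case
      using act_mult[of g h x] G.generate_in_carrier[OF S] U by auto
  qed (use inv in auto)
qed

lemma (in linear_action) act_fixed:
  assumes S: "S \<subseteq> carrier G" and x: "x \<in> carrier M" "\<And>s. s \<in> S \<Longrightarrow> \<rho> s x = x"
    and g: "g \<in> generate G S"
  shows "\<rho> g x = x"
proof -
  interpret G: group G by (rule group)
  have "\<rho> (inv\<^bsub>G\<^esub> s) x = x" if "s \<in> S" for s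
  proof -
    have s: "s \<in> carrier G" using S that by blast
    have "\<rho> (inv\<^bsub>G\<^esub> s) (\<rho> s x) = x"
      unfolding act_mult[OF G.inv_closed[OF s] s x(1), symmetric] G.l_inv[OF s]
      by (rule act_one[OF x(1)])
    then show ?thesis using x(2)[OF that] by simp
  qed
  then have "\<rho> g x \<in> {x}"
    using x g by (intro generate_invariant[OF linear_action_axioms S]) auto
  then show ?thesis by simp
qed

lemma coxeter_inv:
  assumes "coxeter_group W S" "s \<in> S"
  shows "inv\<^bsub>W\<^esub> s = s"
proof -
  interpret group W using assms by (simp add: coxeter_group_def)
  have s: "s \<in> carrier W" "ord s = 2" using assms by (auto simp: coxeter_group_def)
  then have "s \<otimes>\<^bsub>W\<^esub> s = \<one>\<^bsub>W\<^esub>"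
    using pow_ord_eq_1[of s] by (simp add: numeral_2_eq_2)
  then show ?thesis using s(1) by (simp add: inv_equality)
qed

text \<open>For involutions \<open>t s\<close> is the inverse of \<open>s t\<close>, and inverse
  elements have the same order.\<close>

lemma cox_m_sym:
  assumes "coxeter_group W S" "s \<in> S" "t \<in> S"
  shows "cox_m W s t = cox_m W t s"
proof -
  interpret group W using assms by (simp add: coxeter_group_def)
  have st: "s \<in> carrier W" "t \<in> carrier W" using assms by (auto simp: coxeter_group_def)
  then have "inv\<^bsub>W\<^esub> (s \<otimes>\<^bsub>W\<^esub> t) = t \<otimes>\<^bsub>W\<^esub> s"
    using coxeter_inv[OF assms(1)] assms(2,3) by (simp add: inv_mult_group)
  then show ?thesis
    using ord_inv[of "s \<otimes>\<^bsub>W\<^esub> t"] st by (simp add: cox_m_def)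
qed

lemma coxeter_graph_edge:
  assumes "coxeter_group W S"
  shows "{s, t} \<in> edges (coxeter_graph W S) \<longleftrightarrow>
    s \<in> S \<and> t \<in> S \<and> (cox_m W s t \<ge> 3 \<or> cox_m W s t = 0)"
  using cox_m_sym[OF assms] by (auto simp: coxeter_graph_def doubleton_eq_iff)

text \<open>The order of \<open>p b\<close> and \<open>p a\<close> is that of
  \<open>gen_on_basis\<close> with \<open>s = p b\<close>. The test on unordered pairs covers the
  two exceptional rules, one for each direction of the distinguished edge.\<close>

definition edge_coeff ::
    "('w, 'k) monoid_scheme \<Rightarrow> ('b \<Rightarrow> 'w) \<Rightarrow> 'b \<Rightarrow> 'b \<Rightarrow> 'b \<Rightarrow> 'b \<Rightarrow> complex" where
  "edge_coeff W p a1 a2 a b = complex_of_real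
    (if {a, b} = {a1, a2} then 2 * cos (2 * pi / cox_m W (p a1) (p a2))
     else 2 * cos (pi / cox_m W (p b) (p a)))"

lemma edge_coeff_sym:
  assumes "coxeter_group W S" "p a \<in> S" "p b \<in> S"
  shows "edge_coeff W p a1 a2 a b = edge_coeff W p a1 a2 b a"
  using cox_m_sym[OF assms] by (simp add: edge_coeff_def insert_commute)

text \<open>The bijections between neighbourhoods give existence (\<open>lift\<close>) and
  uniqueness (\<open>uniq\<close>) of the lift of an edge at a given vertex. These yield the lifting
  conditions and evaluate the description operator in \<open>gen_on_basis\<close>.\<close>

lemma coxeter_covering_reflections:
  assumes W: "coxeter_group W S"
    and cov: "graph_covering p G' (coxeter_graph W S)" and a12: "{a1, a2} \<in> edges G'"
    and act: "linear_action (free_space (vertices G')) W \<rho>"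
    and gen: "\<And>s a. s \<in> S \<Longrightarrow> a \<in> vertices G' \<Longrightarrow>
      \<rho> s (basis_vec a) = gen_on_basis W S G' p a1 a2 s a"
  shows "covering_reflections (vertices G') S p (\<lambda>a b. {a, b} \<in> edges G') (edge_coeff W p a1 a2) \<rho>"
proof -
  let ?V = "free_space (vertices G')"
  let ?G = "coxeter_graph W S"
  interpret linear_action ?V W \<rho> by fact
  have G': "simple_graph G'" and G: "simple_graph ?G" using cov by (simp_all add: graph_covering_def)
  note edgeD = simple_graph_edgeD[OF G']
  have SW: "s \<in> carrier W" if "s \<in> S" for s using W that by (auto simp: coxeter_group_def)
  have vert: "vertices ?G = S" by (simp add: coxeter_graph_def)
  have p_mem: "p a \<in> S" if "a \<in> vertices G'" for a
    using cov that vert by (auto simp: graph_covering_def)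
  have p_edge: "{p a, p b} \<in> edges ?G" if "{a, b} \<in> edges G'" for a b
    using cov that by (force simp: graph_covering_def)
  have bij: "bij_betw p (neighbours G' a) (neighbours ?G (p a))" if "a \<in> vertices G'" for a
    using cov that by (simp add: graph_covering_def)
  have lift: "\<exists>b. {a, b} \<in> edges G' \<and> p b = t"
    if "a \<in> vertices G'" "{p a, t} \<in> edges ?G" for a t
  proof -
    have "t \<in> neighbours ?G (p a)"
      using that(2) simple_graph_edgeD[OF G that(2)] by (simp add: neighbours_def)
    then have "t \<in> p ` neighbours G' a" using bij[OF that(1)] by (simp add: bij_betw_def)
    then show ?thesis by (auto simp: neighbours_def)
  qed
  have uniq: "b = c" if "{a, b} \<in> edges G'" "{a, c} \<in> edges G'" "p b = p c" for a b c
  proof -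
    have "b \<in> neighbours G' a" "c \<in> neighbours G' a"
      using that edgeD by (auto simp: neighbours_def)
    then show ?thesis
      using bij_betw_imp_inj_on[OF bij[OF edgeD(1)[OF that(1)]]] that(3) by (simp add: inj_on_def)
  qed
  have neq: "p a \<noteq> p b" if "{a, b} \<in> edges G'" for a b
    using simple_graph_edgeD(3)[OF G p_edge[OF that]] .
  show ?thesis
  proof
    show "\<rho> s v \<in> carrier ?V" if "s \<in> S" "v \<in> carrier ?V" for s v
      using act_closed[OF SW[OF that(1)] that(2)] .
    show "\<rho> s (\<lambda>a. v a + w a) = (\<lambda>a. \<rho> s v a + \<rho> s w a)"
      if "s \<in> S" "v \<in> carrier ?V" "w \<in> carrier ?V" for s v w
      using act_add[OF SW[OF that(1)] that(2,3)] by simp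
    show "\<rho> s (\<lambda>a. z * v a) = (\<lambda>a. z * \<rho> s v a)" if "s \<in> S" "v \<in> carrier ?V" for s v z
      using act_smult[OF SW[OF that(1)] that(2), of z] by simp
    show "\<rho> (p a) (basis_vec a) = (\<lambda>b. - basis_vec a b)" if "a \<in> vertices G'" for a
      using gen[OF p_mem[OF that] that] free_space_minus[OF basis_vec_closed[OF that]]
      by (simp add: gen_on_basis_def)
    show "\<exists>b'. {a', b'} \<in> edges G' \<and> p b' = p b"
      if "{a, b} \<in> edges G'" "a' \<in> vertices G'" "p a' = p a" for a b a'
      using lift[OF that(2), of "p b"] p_edge[OF that(1)] that(3) by simp
    show "\<rho> (p b) (basis_vec a) = (\<lambda>c. basis_vec a c + edge_coeff W p a1 a2 a b * basis_vec b c)"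
      if ab: "{a, b} \<in> edges G'" for a b
    proof -
      have "(THE d. d \<in> vertices G' \<and> p d = p b \<and> {a, d} \<in> edges G') = b"
        using ab edgeD(2)[OF ab] uniq by (intro the_equality) auto
      moreover have "{p b, p a} \<in> edges ?G" using p_edge[OF ab] by (simp add: insert_commute)
      moreover have "p b \<noteq> p a" using neq[OF ab] by simp
      \<comment> \<open>The exceptional rules mention only \<open>a\<close> and the image
        \<open>p b\<close>. By uniqueness of lifts these determine \<open>b\<close>, so the rules
        apply to the distinguished edge alone.\<close>
      moreover have "{a, b} = {a1, a2} \<longleftrightarrow> p b = p a1 \<and> a = a2 \<or> p b = p a2 \<and> a = a1"
        using uniq[of a2 a1 b] uniq[of a1 a2 b] ab a12 by (auto simp: insert_commute doubleton_eq_iff)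
      moreover have "p a1 \<noteq> p a2" using neq[OF a12] .
      moreover have "a = a2 \<Longrightarrow> p b = p a1 \<Longrightarrow> b = a1" "a = a1 \<Longrightarrow> p b = p a2 \<Longrightarrow> b = a2"
        using uniq[of a2 a1 b] uniq[of a1 a2 b] ab a12 by (auto simp: insert_commute)
      ultimately show ?thesis
        using gen[OF p_mem[OF edgeD(2)[OF ab]] edgeD(1)[OF ab]]
        by (auto simp: gen_on_basis_def edge_coeff_def Let_def fun_eq_iff)
    qed
    show "\<rho> s (basis_vec a) = basis_vec a"
      if "s \<in> S" "a \<in> vertices G'" "s \<noteq> p a" "\<And>b. {a, b} \<in> edges G' \<Longrightarrow> p b \<noteq> s" for s a
    proof -
      \<comment> \<open>In either exceptional case the other end of the distinguished edge would be
        a neighbour of \<open>a\<close> over \<open>s\<close>.\<close>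
      have special: "\<not> (s = p a1 \<and> a = a2)" "\<not> (s = p a2 \<and> a = a1)"
        using that(4)[of a1] that(4)[of a2] a12 by (auto simp: insert_commute)
      have nonadj: "{s, p a} \<notin> edges ?G"
        using lift[OF that(2), of s] that(4) by (metis insert_commute)
      show ?thesis
        by (simp only: gen[OF that(1,2)] gen_on_basis_def Let_def that(3) special nonadj
            if_False if_True not_False_eq_True)
    qed
    show "b = c" if "{a, b} \<in> edges G'" "{a, c} \<in> edges G'" "p b = p c" for a b c
      by (rule uniq[OF that])
  qed (use p_mem edgeD neq in \<open>auto simp: insert_commute\<close>)
qed

text \<open>The angle \<open>2 * pi / m\<close> lies in the first quadrant and reaches
  \<open>pi / 2\<close> only for \<open>m = 4\<close>; cosine decreases on the interval from 0 to
  \<open>pi\<close>. Nonnegativity is what allows the strict inequality to be squared.\<close>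

lemma cos_edge_facts:
  fixes m :: nat
  assumes "4 \<le> m"
  shows "0 \<le> cos (2 * pi / m)" "cos (2 * pi / m) < cos (pi / m)"
    and "4 < m \<Longrightarrow> cos (2 * pi / m) \<noteq> 0" "m = 4 \<Longrightarrow> cos (2 * pi / m) = 0"
proof -
  have "2 * pi / m \<le> pi / 2" using assms by (simp add: field_simps)
  then show "0 \<le> cos (2 * pi / m)" by (intro cos_ge_zero) (auto intro: order_trans[of _ 0])
  have "2 * pi / m \<le> pi" using \<open>2 * pi / m \<le> pi / 2\<close> pi_gt_zero by linarith
  then show "cos (2 * pi / m) < cos (pi / m)"
    using assms by (intro cos_monotone_0_pi) (auto simp: field_simps)
  show "cos (2 * pi / m) \<noteq> 0" if "4 < m"
  proof -
    have "2 * pi / m < pi / 2" using that by (simp add: field_simps)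
    then have "0 < cos (2 * pi / m)" by (intro cos_gt_zero_pi) (auto intro: less_le_trans[of _ 0])
    then show ?thesis by simp
  qed
  show "cos (2 * pi / m) = 0" if "m = 4" using that by simp
qed

lemma cos_pi_div_pos:
  fixes m :: nat
  assumes "3 \<le> m"
  shows "0 < cos (pi / m)"
proof -
  have "pi / m < pi / 2" using assms by (simp add: field_simps)
  then show ?thesis by (intro cos_gt_zero_pi) (auto intro: less_le_trans[of _ 0])
qed

lemma walk_rtranclp: "walk G xs \<Longrightarrow> (\<lambda>a b. {a, b} \<in> edges G)\<^sup>*\<^sup>* (hd xs) (last xs)"
proof (induction xs)
  case (Cons a xs)
  then show ?case
    by (cases "xs = []") (auto simp: walk_Cons intro: converse_rtranclp_into_rtranclp)
qed (simp add: walk_def)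

text \<open>Passes from subspaces of \<open>V1\<close> to subspaces of \<open>V\<close>, the form in
  which \<open>invariant_subspace_full\<close> takes them.\<close>

lemma free_space_submodule_mono:
  assumes U: "submodule U CC (free_space H)" and "H \<subseteq> A"
  shows "submodule U CC (free_space A)"
proof (rule submodule_CC_I[OF module_free_space])
  note U' = module.submoduleE[OF module_free_space U]
  show "U \<subseteq> carrier (free_space A)" using U'(1) free_space_mono[OF assms(2)] by blast
  show "\<zero>\<^bsub>free_space A\<^esub> \<in> U" using submodule_zero[OF U] by simp
  show "x \<oplus>\<^bsub>free_space A\<^esub> y \<in> U" if "x \<in> U" "y \<in> U" for x y using U'(5)[OF that] by simp
  show "c \<odot>\<^bsub>free_space A\<^esub> x \<in> U" if "x \<in> U" for c x using U'(4)[of c x] that by simp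
qed

section \<open>Irreducibility and infinite dimension of the two quotients\<close>

theorem theorem4p3:
  fixes W :: "('w, 'k) monoid_scheme"
    and S :: "'w set"
    and G' :: "'b ugraph"
    and p :: "'b \<Rightarrow> 'w"
    and s1 s2 :: 'w
    and s1' s2' :: 'b
    and V :: "(complex, 'b \<Rightarrow> complex) module"
    and \<rho> :: "'w \<Rightarrow> ('b \<Rightarrow> complex) \<Rightarrow> ('b \<Rightarrow> complex)"
    and V0 V1 :: "('b \<Rightarrow> complex) set"
    and Vbar V1bar :: "(complex, ('b \<Rightarrow> complex) set) module"
  assumes "irreducible_coxeter W S"
    and "finite S"
    and "\<forall>s\<in>S. \<forall>t\<in>S. cox_m W s t \<noteq> 0"
    and "\<not> tree_graph (coxeter_graph W S)"
    and "s1 \<in> S" and "s2 \<in> S" and "cox_m W s1 s2 \<ge> 4"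
    and "universal_covering p G' (coxeter_graph W S)"
    and "{s1', s2'} \<in> edges G'" and "p s1' = s1" and "p s2' = s2"
    and "infinite (half_tree G' s1' s2')"
    and V: "V = free_space (vertices G')"
    and "representation W V \<rho>"
    and "\<forall>s\<in>S. \<forall>a\<in>vertices G'. \<rho> s (basis_vec a) = gen_on_basis W S G' p s1' s2' s a"
    and V0: "V0 = fixed_space S V \<rho>"
    and V1: "V1 = lin_span V (basis_vec ` half_tree G' s1' s2')"
    and Vbar: "Vbar = quot_space V V0"
    and V1bar: "V1bar = quot_space (V\<lparr>carrier := V1\<rparr>) (V1 \<inter> V0)"
  shows "(cox_m W s1 s2 > 4 \<longrightarrow>
            irreducible_representation W Vbar (quot_action V V0 \<rho>)) \<and>
         (cox_m W s1 s2 = 4 \<longrightarrow>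
            irreducible_representation W V1bar
              (quot_action (V\<lparr>carrier := V1\<rparr>) (V1 \<inter> V0) \<rho>)) \<and>
         infinite_dim Vbar \<and> infinite_dim V1bar"
proof -
  let ?A = "vertices G'" and ?H = "half_tree G' s1' s2'"
  let ?k = "edge_coeff W p s1' s2'" and ?m = "cox_m W s1 s2"
  let ?E = "\<lambda>a b. {a, b} \<in> edges G'"
  have W: "coxeter_group W S" using assms(1) by (simp add: irreducible_coxeter_def)
  then have group_W: "group W" and SW: "S \<subseteq> carrier W" and gen: "generate W S = carrier W"
    by (simp_all add: coxeter_group_def)
  have cov: "graph_covering p G' (coxeter_graph W S)" and tree: "tree_graph G'"
    using assms(8) by (simp_all add: universal_covering_def)
  have G': "simple_graph G'" "connected_graph G'" using tree by (simp_all add: tree_graph_def)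
  have a12: "s1' \<in> ?A" "s2' \<in> ?A" using simple_graph_edgeD[OF G'(1) assms(9)] by auto
  have HA: "?H \<subseteq> ?A" by (auto simp: half_tree_def)
  have linV: "linear_action (free_space ?A) W \<rho>"
    using assms(14) V by (intro representation_linear_action) simp
  interpret linV: linear_action "free_space ?A" W \<rho> by (rule linV)
  interpret R: covering_reflections ?A S p ?E ?k \<rho>
    by (rule coxeter_covering_reflections[OF W cov assms(9) linV]) (use assms(15) in blast)
  have k_sym: "?k a b = ?k b a" if "?E a b" for a b
    using R.p_mem[OF R.N_mem[OF that]] R.p_target_mem[OF that] by (intro edge_coeff_sym[OF W])
  have k_nonzero: "?k a b \<noteq> 0" if "?E a b" "{a, b} \<noteq> {s1', s2'}" for a b
  proof -
    have "{p b, p a} \<in> edges (coxeter_graph W S)"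
    proof -
      have "p ` {a, b} \<in> edges (coxeter_graph W S)"
        using cov that(1) unfolding graph_covering_def by blast
      then show ?thesis by (simp add: insert_commute)
    qed
    \<comment> \<open>An edge also allows the value 0, which encodes infinite order; the finiteness
      assumption rules it out.\<close>
    then have "cox_m W (p b) (p a) \<ge> 3"
      using assms(3) unfolding coxeter_graph_edge[OF W] by blast
    from cos_pi_div_pos[OF this] show ?thesis using that(2) by (simp add: edge_coeff_def)
  qed
  have k_special: "?k s1' s2' = 2 * cos (2 * pi / ?m)" "?k s2' s1' = 2 * cos (2 * pi / ?m)"
    using assms(10,11) by (simp_all add: edge_coeff_def insert_commute)
  \<comment> \<open>The product of the two coefficients along an ordinary edge over
    \<open>s1\<close> and \<open>s2\<close>.\<close>
  define c where "c = complex_of_real ((2 * cos (pi / ?m))\<^sup>2)"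
  have c: "?k s1' s2' * ?k s2' s1' \<noteq> c"
  proof -
    have "(2 * cos (2 * pi / ?m))\<^sup>2 < (2 * cos (pi / ?m))\<^sup>2"
      using cos_edge_facts(1,2)[OF assms(7)] by (intro power_strict_mono) auto
    then have "complex_of_real ((2 * cos (2 * pi / ?m))\<^sup>2) \<noteq> c"
      unfolding c_def of_real_eq_iff by simp
    then show ?thesis by (simp add: k_special power2_eq_square)
  qed
  have generic: "?k a b * ?k b a = c"
    if "?E a b" "p a = p s1'" "p b = p s2'" "a \<noteq> s1'" for a b
  proof -
    have "p s1' \<noteq> p s2'" using R.N_neq[OF assms(9)] .
    then have "{a, b} \<noteq> {s1', s2'}" using that by (auto simp: doubleton_eq_iff)
    then have "?k a b = 2 * cos (pi / ?m)"
      using that cox_m_sym[OF W assms(6,5)] assms(10,11) by (simp add: edge_coeff_def)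
    then show ?thesis using k_sym[OF that(1)] by (simp add: c_def power2_eq_square)
  qed
  have V0_eq: "V0 = {v \<in> carrier (free_space ?A). \<forall>s\<in>S. \<rho> s v = v}"
    by (simp add: V0 V fixed_space_def)
  have V0_fixed: "\<rho> g v = v" if "g \<in> carrier W" "v \<in> V0" for g v
    using that linV.act_fixed[OF SW] by (simp add: V0_eq gen)
  have V0_sub: "submodule V0 CC (free_space ?A)"
    by (rule submodule_CC_I[OF module_free_space])
      (auto simp: V0_eq free_space_zero_closed free_space_add_closed free_space_smult_closed
        R.act_zero R.add R.smult)
  have V1_eq: "V1 = carrier (free_space ?H)"
    unfolding V1 V by (rule lin_span_basis_vec[OF HA])
  have V1_mod: "V\<lparr>carrier := V1\<rparr> = free_space ?H"
    unfolding V1_eq V by (rule free_space_update)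
  have V1_sub: "submodule V1 CC (free_space ?A)"
    unfolding V1_eq by (rule free_space_submodule_mono[OF _ HA])
      (rule module.carrier_is_submodule[OF module_free_space])
  have V10_sub: "submodule (V1 \<inter> V0) CC (free_space ?H)"
  proof (rule submodule_CC_I[OF module_free_space])
    note V0' = module.submoduleE[OF module_free_space V0_sub]
    note V1' = module.submoduleE[OF module_free_space V1_sub]
    show "\<zero>\<^bsub>free_space ?H\<^esub> \<in> V1 \<inter> V0"
      using submodule_zero[OF V0_sub] submodule_zero[OF V1_sub] by simp
    show "x \<oplus>\<^bsub>free_space ?H\<^esub> y \<in> V1 \<inter> V0" if "x \<in> V1 \<inter> V0" "y \<in> V1 \<inter> V0" for x y
      using that V0'(5)[of x y] V1'(5)[of x y] by simp
    show "z \<odot>\<^bsub>free_space ?H\<^esub> x \<in> V1 \<inter> V0" if "x \<in> V1 \<inter> V0" for z x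
      using that V0'(4)[of z x] V1'(4)[of z x] by simp
  qed (simp add: V1_eq)
  \<comment> \<open>The common core of both irreducibility claims: \<open>B\<close> will be the
    whole vertex set for order above 4 and the half tree for order 4.\<close>
  have full: "carrier (free_space B) \<subseteq> U"
    if U: "submodule U CC (free_space ?A)" "\<And>g v. g \<in> carrier W \<Longrightarrow> v \<in> U \<Longrightarrow> \<rho> g v \<in> U"
      "U \<subseteq> carrier (free_space B)" "\<not> U \<subseteq> V0"
      and conn: "\<And>a. a \<in> B \<Longrightarrow> (\<lambda>a b. ?E a b \<and> ?k a b \<noteq> 0 \<and> ?k b a \<noteq> 0)\<^sup>*\<^sup>* a s1'" for U B
  proof -
    obtain v where v: "v \<in> U" "v \<notin> V0" using U(4) by blast
    moreover have "v \<in> carrier (free_space ?A)"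
      using v(1) module.submoduleE(1)[OF module_free_space U(1)] by blast
    ultimately obtain s where s: "s \<in> S" "\<rho> s v \<noteq> v" by (auto simp: V0_eq)
    show ?thesis
      by (rule R.invariant_subspace_full[OF U(1) _ U(3) assms(9) c generic conn v(1) s])
        (use U(2) SW in blast)+
  qed
  \<comment> \<open>This makes both quotients nonzero.\<close>
  have s1'_not_fixed: "basis_vec s1' \<notin> V0"
  proof
    assume "basis_vec s1' \<in> V0"
    then have "basis_vec s1' = (\<lambda>b. - basis_vec s1' b)"
      using R.gen_neg[OF a12(1)] R.p_mem[OF a12(1)] by (simp add: V0_eq)
    from fun_cong[OF this, of s1'] show False by (simp add: basis_vec_def)
  qed
  have H1: "s1' \<in> ?H"
  proof -
    have "graph_dist G' s1' s2' \<noteq> 0"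
      using graph_dist_eq_0[OF G'(2) a12] simple_graph_edgeD(3)[OF G'(1) assms(9)] by blast
    then show ?thesis using a12 graph_dist_self[OF a12(1)] by (simp add: half_tree_def)
  qed
  have H2: "s2' \<notin> ?H" using graph_dist_self[OF a12(2)] by (simp add: half_tree_def)

  have "irreducible_representation W Vbar (quot_action V V0 \<rho>)" if m: "?m > 4"
  proof -
    interpret Q: quotient_action "free_space ?A" W \<rho> V0
      by (intro quotient_action.intro module_quotient.intro module_quotient_axioms.intro
          quotient_action_axioms.intro linV module_free_space V0_sub)
        (simp add: V0_fixed)
    have "?k a b \<noteq> 0" if "?E a b" for a b
    proof (cases "{a, b} = {s1', s2'}")
      case True
      then show ?thesis
        using cos_edge_facts(3)[OF assms(7) m] assms(10,11) by (simp add: edge_coeff_def)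
    qed (rule k_nonzero[OF that])
    then have rel: "(\<lambda>a b. ?E a b \<and> ?k a b \<noteq> 0 \<and> ?k b a \<noteq> 0) = ?E"
      by (auto simp: fun_eq_iff insert_commute)
    have conn: "(\<lambda>a b. ?E a b \<and> ?k a b \<noteq> 0 \<and> ?k b a \<noteq> 0)\<^sup>*\<^sup>* a s1'" if a: "a \<in> ?A" for a
    proof -
      obtain xs where "walk G' xs" "hd xs = a" "last xs = s1'"
        using graph_dist_walk[OF G'(2) a a12(1)] .
      then show ?thesis unfolding rel using walk_rtranclp by metis
    qed
    have "irreducible_representation W Q.Q (quot_action (free_space ?A) V0 \<rho>)"
    proof (rule Q.irreducible_Q)
      show "V0 \<noteq> carrier (free_space ?A)" using s1'_not_fixed basis_vec_closed[OF a12(1)] by blast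
      fix U assume U: "submodule U CC (free_space ?A)" "\<not> U \<subseteq> V0"
        "\<And>g x. g \<in> carrier W \<Longrightarrow> x \<in> U \<Longrightarrow> \<rho> g x \<in> U"
      have "U \<subseteq> carrier (free_space ?A)" using module.submoduleE(1)[OF module_free_space U(1)] .
      then show "U = carrier (free_space ?A)" using full[OF U(1,3) _ U(2) conn] by blast
    qed
    then show ?thesis by (simp add: Vbar V)
  qed
  moreover have "irreducible_representation W V1bar
      (quot_action (V\<lparr>carrier := V1\<rparr>) (V1 \<inter> V0) \<rho>)" if m: "?m = 4"
  proof -
    have boundary: "?k a b = 0" if "a \<in> ?H" "?E a b" "b \<notin> ?H" for a b
    proof -
      \<comment> \<open>The only edge leaving the half tree is the distinguished one, whose
        coefficient is \<open>2 * cos (pi / 2)\<close>.\<close>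
      have "a = s1'" "b = s2'"
        using half_tree_boundary[OF tree assms(9) that(2,1,3)] by simp_all
      then show ?thesis using k_special(1) cos_edge_facts(4)[OF assms(7) m] by simp
    qed
    have inv_S: "\<rho> s v \<in> V1" if "s \<in> S" "v \<in> V1" for s v
      using R.act_closed_subset[OF HA that(1), of v] that(2) boundary unfolding V1_eq by blast
    have inv: "\<rho> g v \<in> V1" if "g \<in> carrier W" "v \<in> V1" for g v
    proof (rule generate_invariant[OF linV SW])
      show "V1 \<subseteq> carrier (free_space ?A)" using module.submoduleE(1)[OF module_free_space V1_sub] .
      show "g \<in> generate W S" using that gen by simp
      show "\<rho> s x \<in> V1 \<and> \<rho> (inv\<^bsub>W\<^esub> s) x \<in> V1" if "s \<in> S" "x \<in> V1" for s x
        using inv_S[OF that] coxeter_inv[OF W that(1)] by simp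
    qed (rule that(2))
    have lin1: "linear_action (free_space ?H) W \<rho>"
      using linear_action_submodule[OF linV V1_sub inv] by (simp add: V1_eq free_space_update)
    interpret Q: quotient_action "free_space ?H" W \<rho> "V1 \<inter> V0"
      by (intro quotient_action.intro module_quotient.intro module_quotient_axioms.intro
          quotient_action_axioms.intro lin1 module_free_space V10_sub)
        (simp add: V0_fixed)
    \<comment> \<open>Geodesics to \<open>s1'\<close> stay inside the half tree. They avoid the
      distinguished edge, since its end \<open>s2'\<close> lies outside, and all other coefficients
      are nonzero.\<close>
    have conn: "(\<lambda>a b. ?E a b \<and> ?k a b \<noteq> 0 \<and> ?k b a \<noteq> 0)\<^sup>*\<^sup>* a s1'" if "a \<in> ?H" for a
      using that
    proof (induction "graph_dist G' a s1'" arbitrary: a rule: less_induct)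
      case less
      show ?case
      proof (cases "a = s1'")
        case False
        obtain b where b: "?E a b" "b \<in> ?H" "graph_dist G' b s1' < graph_dist G' a s1'"
          using half_tree_step[OF G' a12 less.prems False] .
        have "{a, b} \<noteq> {s1', s2'}" using H2 less.prems b(2) by (auto simp: doubleton_eq_iff)
        then have "?k a b \<noteq> 0" using k_nonzero[OF b(1)] by simp
        then show ?thesis
          using less.hyps[OF b(3,2)] b(1) k_sym[OF b(1)]
          by (intro converse_rtranclp_into_rtranclp[of _ a b]) auto
      qed simp
    qed
    have "irreducible_representation W Q.Q (quot_action (free_space ?H) (V1 \<inter> V0) \<rho>)"
    proof (rule Q.irreducible_Q)
      show "V1 \<inter> V0 \<noteq> carrier (free_space ?H)"
        using s1'_not_fixed basis_vec_closed[OF H1] by blast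
      fix U assume U: "submodule U CC (free_space ?H)" "\<not> U \<subseteq> V1 \<inter> V0"
        "\<And>g x. g \<in> carrier W \<Longrightarrow> x \<in> U \<Longrightarrow> \<rho> g x \<in> U"
      have UH: "U \<subseteq> carrier (free_space ?H)"
        using module.submoduleE(1)[OF module_free_space U(1)] .
      then have "\<not> U \<subseteq> V0" using U(2) V1_eq by blast
      then show "U = carrier (free_space ?H)"
        using full[OF free_space_submodule_mono[OF U(1) HA] U(3) UH _ conn] UH by blast
    qed
    then show ?thesis by (simp add: V1bar V1_mod)
  qed
  \<comment> \<open>The infinite half tree lies over the finite set \<open>S\<close>, so some fibre
    meets it in infinitely many points. The same \<open>s\<close> serves both quotients.\<close>
  moreover obtain s where s: "s \<in> S" "infinite {a \<in> ?H. p a = s}"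
  proof -
    have "finite (p ` ?H)"
      using R.p_mem HA by (intro finite_subset[OF _ assms(2)]) blast
    from pigeonhole_infinite[OF assms(12) this] obtain a where
      "a \<in> ?H" "infinite {b \<in> ?H. p b = p a}" by blast
    then show ?thesis using that[of "p a"] R.p_mem HA by blast
  qed
  moreover have "infinite_dim Vbar"
  proof -
    have "infinite {a \<in> ?A. p a = s}"
      using s(2) by (rule infinite_super[rotated]) (use HA in blast)
    from R.infinite_dim_quotient[OF order_refl s(1) this V0_sub] show ?thesis
      using s(1) by (simp add: Vbar V V0_eq)
  qed
  moreover have "infinite_dim V1bar"
    unfolding V1bar V1_mod
    by (rule R.infinite_dim_quotient[OF HA s V10_sub]) (use s(1) V0_eq in blast)
  ultimately show ?thesis by blast
qed

end
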